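(* Consider the dyadic regression model with graphon missingness, the node split $D_1,D_2$, and the weighted conformal set $\widehat C^{\mathrm{weighted}}_{kl}$ at level $\alpha\in(0,1)$, all as defined in the context, with $\hat Y_{ij}=\hat h(X_i,X_j)$ and with any choice of nonconformity score. Suppose moreover that: (a) $w(x,y)\ge c>0$ and $\hat p_{ij}/\rho_n\ge c>0$ for some $c>0$; (b) $\rho_n=\omega(\sqrt{\log n}/n)$; (c) $\dfrac1{n^2\rho_n^3}E\bigl[\|\hat P-P\|_F^2\bigr]=o(1)$. Then, for any $k,l\in D_2$ satisfying $k<l$, $$\liminf_{n\to\infty}P\left(Y_{kl}\in\widehat C^{\mathrm{weighted}}_{kl}\mid M_{kl}=0\right)\ge 1-\alpha.$$
   Context: Asymptotics are as $n\to\infty$ along even $n$; the pair $k=k_n<l=l_n$ in $D_2$ may depend on $n$. Model (dyadic regression with graphon missingness): $(X_1,\xi_1,\zeta_1),\dots,(X_n,\xi_n,\zeta_n)$ are i.i.d. from a distribution, with $\xi_i\in[0,1]$; $(\eta_{ij})_{1\le i<j\le n}$ and $(\nu_{ij})_{1\le i<j\le n}$ are collections of i.i.d. random variables independent of all other random variables, with $\eta_{ij}\sim\mathrm{Uniform}[0,1]$. $Y_{ij}=Y_{ji}$ and $M_{ij}=M_{ji}$ for $i\ne j$, and for measurable $g$, $w$ and $i<j$, $$Y_{ij}=g(X_i,\zeta_i,X_j,\zeta_j,\nu_{ij}),\qquad M_{ij}=\mathbf 1\bigl(\eta_{ij}\le\rho_n w(\xi_i,\xi_j)\wedge1\bigr),$$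 where $\int_0^1\int_0^1w(u,v)\,du\,dv=1$, $0<c<w(x,y)<C<\infty$, $\rho_n>0$ and $\rho_n\to0$. $M_{ij}=1$ means that $Y_{ij}$ is observed, $M_{ij}=0$ that it is missing. Split conformal with deterministic node splitting: $N=n/2$, $D_1=\{1,\dots,N\}$, $D_2=\{N+1,\dots,n\}$. The training set is $\mathcal H_1=\{\{i,j\}: M_{ij}=1,\ i,j\in D_1\}$, the calibration set is $\mathcal H_2=\{\{i,j\}: M_{ij}=1,\ i,j\in D_2\}$, and for a missing test pair, $\mathcal K_{kl}=\mathcal H_2\cup\{\{k,l\}\}$. The function $\hat h$ is trained on the training data, and $S_{ij}=s(Y_{ij},\hat Y_{ij})$ for a measurable nonconformity score $s$ (possibly fitted on the training data). Graphon estimation: $P=(\rho_nw(\xi_i,\xi_j))_{1\le i,j\le n}=(p_{ij})$, and $\hat P=(\hat p_{ij})_{1\le i,j\le n}$ is an estimator of $P$; $\|\cdot\|_F$ is the Frobenius norm. Let $\hat\rho_n=\binom N2^{-1}\sum_{N+1\le i<j\le n}M_{ij}$. Weighted conformal set: for $k,l\in D_2$ with $M_{kl}=0$, $$\Pi^{\mathrm{weighted}}_{kl}=\frac1{\binom N2(1-\hat\rho_n)}\sum_{\{i,j\}\in\mathcal K_{kl}}\frac{1-\hat p_{ij}}{\hat p_{ij}}\mathbf 1(S_{ij}\ge S_{kl}),\qquad \widehat C^{\mathrm{weighted}}_{kl}=\{y_{kl}:\Pi^{\mathrm{weighted}}_{kl}>\alpha\},$$ where $\Pi^{\mathrm{weighted}}_{kl}$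 is regarded as a function of the candidate value $y_{kl}$ substituted for $Y_{kl}$. $a_n=\omega(b_n)$ means $a_n/b_n\to\infty$. *)

theory Defs
  imports "HOL-Probability.Probability"
begin

abbreviation unit_interval :: "real measure"
  where "unit_interval \<equiv> restrict_space borel {0..1}"

text \<open>An unordered pair of distinct nodes is represented by its increasing enumeration.\<close>

definition pairs :: "nat set \<Rightarrow> (nat \<times> nat) set"
  where "pairs D = {(i, j). i \<in> D \<and> j \<in> D \<and> i < j}"

text \<open>The function \<open>w\<close> is not assumed to be symmetric.\<close>

definition normalized_graphon :: "(real \<Rightarrow> real \<Rightarrow> real) \<Rightarrow> bool"
  where "normalized_graphon w \<longleftrightarrow>
    (\<lambda>(u, v). w u v) \<in> borel_measurable (unit_interval \<Otimes>\<^sub>M unit_interval) \<and>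
    (LBINT u:{0..1}. (LBINT v:{0..1}. w u v)) = 1 \<and>
    (\<exists>c C. 0 < c \<and> (\<forall>u\<in>{0..1}. \<forall>v\<in>{0..1}. c < w u v \<and> w u v < C))"

datatype source = Node nat | Eta "nat \<times> nat" | Nu "nat \<times> nat"

text \<open>A sample with nodes \<open>{1..n}\<close>. The parameters that do not change with \<open>n\<close> are the law
  \<open>LV\<close> of \<open>(X\<^sub>i, \<xi>\<^sub>i, \<zeta>\<^sub>i)\<close>, the law \<open>LN\<close> of \<open>\<nu>\<^sub>i\<^sub>j\<close>, the functions \<open>g\<close> and \<open>w\<close>, and the
  measurable spaces \<open>MX\<close>, \<open>MZ\<close>, \<open>MV\<close>, \<open>MY\<close> in which covariates, latent variables, edge noise
  and responses take their values. The library's \<open>indep_vars\<close> only covers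
  variables of one common type, so mutual independence of all the node triples, all \<open>\<eta>\<^sub>i\<^sub>j\<close> and all
  \<open>\<nu>\<^sub>i\<^sub>j\<close> is stated as \<open>indep_sets\<close> of their preimage systems, indexed by the type \<open>source\<close>.\<close>

locale dyadic_regression = prob_space \<Omega>
  for \<Omega> :: "'a measure" +
  fixes MX :: "'x measure" and MZ :: "'z measure" and MV :: "'v measure" and MY :: "'y measure"
    and LV :: "('x \<times> real \<times> 'z) measure" and LN :: "'v measure"
    and g :: "'x \<times> 'z \<times> 'x \<times> 'z \<times> 'v \<Rightarrow> 'y" and w :: "real \<Rightarrow> real \<Rightarrow> real"
    and n :: nat and \<rho> :: real
    and X :: "nat \<Rightarrow> 'a \<Rightarrow> 'x" and \<xi> :: "nat \<Rightarrow> 'a \<Rightarrow> real" and \<zeta> :: "nat \<Rightarrow> 'a \<Rightarrow> 'z"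
    and \<eta> :: "nat \<times> nat \<Rightarrow> 'a \<Rightarrow> real" and \<nu> :: "nat \<times> nat \<Rightarrow> 'a \<Rightarrow> 'v"
    and Y :: "nat \<Rightarrow> nat \<Rightarrow> 'a \<Rightarrow> 'y" and M :: "nat \<Rightarrow> nat \<Rightarrow> 'a \<Rightarrow> real"
  assumes g_measurable: "g \<in> MX \<Otimes>\<^sub>M MZ \<Otimes>\<^sub>M MX \<Otimes>\<^sub>M MZ \<Otimes>\<^sub>M MV \<rightarrow>\<^sub>M MY"
    and graphon: "normalized_graphon w"
    and rho_pos: "0 < \<rho>"
    and nodes_measurable: "\<And>i. i \<in> {1..n} \<Longrightarrow>
        random_variable (MX \<Otimes>\<^sub>M unit_interval \<Otimes>\<^sub>M MZ) (\<lambda>\<omega>. (X i \<omega>, \<xi> i \<omega>, \<zeta> i \<omega>))"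
    and eta_measurable: "\<And>p. p \<in> pairs {1..n} \<Longrightarrow> random_variable borel (\<eta> p)"
    and nu_measurable: "\<And>p. p \<in> pairs {1..n} \<Longrightarrow> random_variable MV (\<nu> p)"
    and nodes_law: "\<And>i. i \<in> {1..n} \<Longrightarrow>
        distr \<Omega> (MX \<Otimes>\<^sub>M unit_interval \<Otimes>\<^sub>M MZ) (\<lambda>\<omega>. (X i \<omega>, \<xi> i \<omega>, \<zeta> i \<omega>)) = LV"
    and eta_law: "\<And>p. p \<in> pairs {1..n} \<Longrightarrow> distr \<Omega> borel (\<eta> p) = uniform_measure lborel {0..1}"
    and nu_law: "\<And>p. p \<in> pairs {1..n} \<Longrightarrow> distr \<Omega> MV (\<nu> p) = LN"
    and indep: "indep_sets
        (\<lambda>a. case a of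
            Node i \<Rightarrow> {(\<lambda>\<omega>. (X i \<omega>, \<xi> i \<omega>, \<zeta> i \<omega>)) -` A \<inter> space \<Omega> | A.
                        A \<in> sets (MX \<Otimes>\<^sub>M unit_interval \<Otimes>\<^sub>M MZ)}
          | Eta p \<Rightarrow> {\<eta> p -` A \<inter> space \<Omega> | A. A \<in> sets borel}
          | Nu p \<Rightarrow> {\<nu> p -` A \<inter> space \<Omega> | A. A \<in> sets MV})
        (Node ` {1..n} \<union> Eta ` pairs {1..n} \<union> Nu ` pairs {1..n})"
    and Y_eq: "\<And>i j \<omega>. (i, j) \<in> pairs {1..n} \<Longrightarrow> \<omega> \<in> space \<Omega> \<Longrightarrow>
        Y i j \<omega> = g (X i \<omega>, \<zeta> i \<omega>, X j \<omega>, \<zeta> j \<omega>, \<nu> (i, j) \<omega>) \<and> Y j i \<omega> = Y i j \<omega>"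
    and M_eq: "\<And>i j \<omega>. (i, j) \<in> pairs {1..n} \<Longrightarrow> \<omega> \<in> space \<Omega> \<Longrightarrow>
        M i j \<omega> = of_bool (\<eta> (i, j) \<omega> \<le> min (\<rho> * w (\<xi> i \<omega>) (\<xi> j \<omega>)) 1) \<and> M j i \<omega> = M i j \<omega>"

text \<open>The \<sigma>-algebra generated by the data available on the node set \<open>D\<close>: the covariates, the
  missingness indicators, and the responses of the observed pairs. Being a (measurable) function
  of these data is rendered as measurability with respect to this \<sigma>-algebra.\<close>

definition observed_data ::
  "'a measure \<Rightarrow> 'x measure \<Rightarrow> 'y measure \<Rightarrow> (nat \<Rightarrow> 'a \<Rightarrow> 'x) \<Rightarrow> (nat \<Rightarrow> nat \<Rightarrow> 'a \<Rightarrow> 'y) \<Rightarrow>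
   (nat \<Rightarrow> nat \<Rightarrow> 'a \<Rightarrow> real) \<Rightarrow> nat set \<Rightarrow> 'a measure"
  where "observed_data \<Omega> MX MY X Y M D = sigma (space \<Omega>)
    ({{\<omega> \<in> space \<Omega>. X i \<omega> \<in> A} | i A. i \<in> D \<and> A \<in> sets MX} \<union>
     {{\<omega> \<in> space \<Omega>. M i j \<omega> = 1} | i j. (i, j) \<in> pairs D} \<union>
     {{\<omega> \<in> space \<Omega>. M i j \<omega> = 1 \<and> Y i j \<omega> \<in> B} | i j B. (i, j) \<in> pairs D \<and> B \<in> sets MY})"

definition D1 :: "nat \<Rightarrow> nat set"
  where "D1 n = {1..n div 2}"

definition D2 :: "nat \<Rightarrow> nat set"
  where "D2 n = {n div 2 + 1..n}"

definition calibration_set :: "nat \<Rightarrow> (nat \<Rightarrow> nat \<Rightarrow> 'a \<Rightarrow> real) \<Rightarrow> 'a \<Rightarrow> (nat \<times> nat) set"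
  where "calibration_set n M \<omega> = {(i, j) \<in> pairs (D2 n). M i j \<omega> = 1}"

definition rho_hat :: "nat \<Rightarrow> (nat \<Rightarrow> nat \<Rightarrow> 'a \<Rightarrow> real) \<Rightarrow> 'a \<Rightarrow> real"
  where "rho_hat n M \<omega> = (\<Sum>(i, j)\<in>pairs (D2 n). M i j \<omega>) / real (n div 2 choose 2)"

text \<open>\<open>S\<^sub>i\<^sub>j\<close> as a function of the candidate value \<open>y\<close> substituted for \<open>Y\<^sub>k\<^sub>l\<close>. The fitted score \<open>s\<close>
  and the fitted regression function \<open>h\<close> are random, hence the argument \<open>\<omega>\<close>.\<close>

definition score_at ::
  "(nat \<Rightarrow> 'a \<Rightarrow> 'x) \<Rightarrow> (nat \<Rightarrow> nat \<Rightarrow> 'a \<Rightarrow> 'y) \<Rightarrow> ('a \<Rightarrow> 'x \<Rightarrow> 'x \<Rightarrow> 'p) \<Rightarrow> ('a \<Rightarrow> 'y \<Rightarrow> 'p \<Rightarrow> real) \<Rightarrow>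
   nat \<Rightarrow> nat \<Rightarrow> 'a \<Rightarrow> 'y \<Rightarrow> nat \<Rightarrow> nat \<Rightarrow> real"
  where "score_at X Y h s k l \<omega> y i j =
    s \<omega> (if (i, j) = (k, l) then y else Y i j \<omega>) (h \<omega> (X i \<omega>) (X j \<omega>))"

definition Pi_weighted ::
  "nat \<Rightarrow> (nat \<Rightarrow> 'a \<Rightarrow> 'x) \<Rightarrow> (nat \<Rightarrow> nat \<Rightarrow> 'a \<Rightarrow> 'y) \<Rightarrow> (nat \<Rightarrow> nat \<Rightarrow> 'a \<Rightarrow> real) \<Rightarrow>
   ('a \<Rightarrow> 'x \<Rightarrow> 'x \<Rightarrow> 'p) \<Rightarrow> ('a \<Rightarrow> 'y \<Rightarrow> 'p \<Rightarrow> real) \<Rightarrow> (nat \<Rightarrow> nat \<Rightarrow> 'a \<Rightarrow> real) \<Rightarrow>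
   nat \<Rightarrow> nat \<Rightarrow> 'a \<Rightarrow> 'y \<Rightarrow> real"
  where "Pi_weighted n X Y M h s p_hat k l \<omega> y =
    1 / (real (n div 2 choose 2) * (1 - rho_hat n M \<omega>)) *
    (\<Sum>(i, j)\<in>insert (k, l) (calibration_set n M \<omega>).
       (1 - p_hat i j \<omega>) / p_hat i j \<omega> *
       of_bool (score_at X Y h s k l \<omega> y i j \<ge> score_at X Y h s k l \<omega> y k l))"

definition C_weighted ::
  "'y measure \<Rightarrow> real \<Rightarrow> nat \<Rightarrow> (nat \<Rightarrow> 'a \<Rightarrow> 'x) \<Rightarrow> (nat \<Rightarrow> nat \<Rightarrow> 'a \<Rightarrow> 'y) \<Rightarrow>
   (nat \<Rightarrow> nat \<Rightarrow> 'a \<Rightarrow> real) \<Rightarrow> ('a \<Rightarrow> 'x \<Rightarrow> 'x \<Rightarrow> 'p) \<Rightarrow> ('a \<Rightarrow> 'y \<Rightarrow> 'p \<Rightarrow> real) \<Rightarrow>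
   (nat \<Rightarrow> nat \<Rightarrow> 'a \<Rightarrow> real) \<Rightarrow> nat \<Rightarrow> nat \<Rightarrow> 'a \<Rightarrow> 'y set"
  where "C_weighted MY \<alpha> n X Y M h s p_hat k l \<omega> =
    {y \<in> space MY. Pi_weighted n X Y M h s p_hat k l \<omega> y > \<alpha>}"

text \<open>The squared Frobenius norm can have infinite expectation, so the expectation is taken as a
  Lebesgue integral in \<open>[0, \<infinity>]\<close>.\<close>

definition expected_sq_frobenius ::
  "'a measure \<Rightarrow> nat \<Rightarrow> (nat \<Rightarrow> nat \<Rightarrow> 'a \<Rightarrow> real) \<Rightarrow> ennreal"
  where "expected_sq_frobenius \<Omega> n A =
    (\<integral>\<^sup>+ \<omega>. ennreal ((L2_set (\<lambda>(i, j). A i j \<omega>) ({1..n} \<times> {1..n}))\<^sup>2) \<partial>\<Omega>)"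

definition along_even :: "nat filter"
  where "along_even = inf sequentially (principal {n. even n})"

end

theory Submission
  imports Defs
begin

text \<open>Since \<open>\<rho>\<close> tends to \<open>0\<close>, the conditioning on \<open>M\<^sub>k\<^sub>l = 0\<close> and the factor \<open>1 - rho_hat\<close> are
  asymptotically irrelevant, and up to \<open>o(1)\<close> the weighted conformal p-value is the inverse propensity
  weighted average of \<open>M\<^sub>e / p\<^sub>e \<sqdot> 1(S\<^sub>e \<ge> S\<^sub>k\<^sub>l)\<close> over the pairs \<open>e\<close> of \<open>D\<^sub>2\<close>; replacing the estimated
  propensities by the true ones costs little by Young's inequality and assumption (c). Let \<open>G\<close> be the
  survival function of the score of a fresh pair given the training data. Conditionally on the training
  data and the test pair, each term with \<open>e\<close> disjoint from \<open>{k, l}\<close> has mean \<open>G(S\<^sub>k\<^sub>l)\<close>, and terms of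
  disjoint pairs are uncorrelated, so that the variance of the average is of order
  \<open>1 / (n\<^sup>2 \<rho>) + 1 / n\<close>. Hence the p-value is at least \<open>G(S\<^sub>k\<^sub>l) - o(1)\<close> with high probability,
  and \<open>G(S\<^sub>k\<^sub>l) \<le> \<beta>\<close> has probability at most \<open>\<beta>\<close>.\<close>

section \<open>Pairs, survival functions and independence\<close>

text \<open>The main obstacle is that \<open>p_hat\<close> may depend on all the data, the
  calibration part included, so no conditional mean is available for a term that contains it. It is
  therefore compared with the true propensity outcome by outcome, before independence is used; only
  terms with true propensities are averaged. The fitted score depends on \<open>D1 n\<close> alone,
  hence can be frozen while pairs of \<open>D2 n\<close> are integrated out. The scale in (c) is
  that of this comparison. Replacing one weight costs about |p_hat - p| / rho^2, and only the order
  of n^2 rho pairs is observed. Young's inequality with a weight proportional to rho balances the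
  number of observed pairs against the squared error, and after division by the number of pairs the
  squared error appears over n^2 rho^3. Assumption (b) enters through rho >= 1/n, which brings the
  diagonal variance 1/(n^2 rho) to the order 1/n of the covariances of pairs that share a node.
  Coverage needs only a lower bound for the p-value, so the pairs that share a node with the test
  pair, at most n of them, can be discarded.\<close>

lemma finite_pairs:
  assumes "finite D" shows "finite (pairs D)"
  by (rule finite_subset[of _ "D \<times> D"]) (use assms in \<open>auto simp: pairs_def\<close>)

lemma card_pairs:
  assumes "finite D"
  shows "card (pairs D) = card D choose 2"
proof -
  have "bij_betw (\<lambda>(i, j). {i, j}) (pairs D) {K. K \<subseteq> D \<and> card K = 2}"
    unfolding bij_betw_def
  proof
    show "inj_on (\<lambda>(i, j). {i, j}) (pairs D)"
      by (auto simp: inj_on_def pairs_def doubleton_eq_iff)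
    have "K \<in> (\<lambda>(i, j). {i, j}) ` pairs D" if K: "K \<subseteq> D" "card K = 2" for K
    proof -
      obtain x y where xy: "K = {x, y}" "x \<noteq> y"
        using K(2) by (meson card_2_iff)
      then have "K = {min x y, max x y}" "(min x y, max x y) \<in> pairs D"
        using K(1) by (auto simp: pairs_def min_def max_def)
      then show ?thesis
        by force
    qed
    then show "(\<lambda>(i, j). {i, j}) ` pairs D = {K. K \<subseteq> D \<and> card K = 2}"
      by (auto simp: pairs_def)
  qed
  then show ?thesis
    using n_subsets[OF assms, of 2] by (simp add: bij_betw_same_card)
qed

lemma pairs_mono: "D \<subseteq> D' \<Longrightarrow> pairs D \<subseteq> pairs D'"
  by (auto simp: pairs_def)

text \<open>Every such pair is the sorted form of some \<open>(u, v)\<close> with \<open>u\<close>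
  in \<open>{a, b}\<close> and \<open>v\<close> in \<open>D\<close>. A linear count is what makes
  these pairs negligible among quadratically many.\<close>

lemma card_pairs_meeting:
  assumes "finite D"
  shows "card {(i, j) \<in> pairs D. {i, j} \<inter> {a, b} \<noteq> {}} \<le> 2 * card D"
proof -
  let ?f = "\<lambda>(u, v). (min u v, max u v) :: nat \<times> nat"
  have "{(i, j) \<in> pairs D. {i, j} \<inter> {a, b} \<noteq> {}} \<subseteq> ?f ` ({a, b} \<times> D)"
  proof (rule subsetI, clarify)
    fix i j assume "(i, j) \<in> pairs D" "{i, j} \<inter> {a, b} \<noteq> {}"
    then have "?f (i, j) = (i, j)" "?f (j, i) = (i, j)" "i \<in> D" "j \<in> D" "i \<in> {a, b} \<or> j \<in> {a, b}"
      by (auto simp: pairs_def)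
    then show "(i, j) \<in> ?f ` ({a, b} \<times> D)"
      by (metis (no_types, lifting) SigmaI image_eqI)
  qed
  then have "card {(i, j) \<in> pairs D. {i, j} \<inter> {a, b} \<noteq> {}} \<le> card ({a, b} \<times> D)"
    using assms by (meson card_image_le card_mono finite_SigmaI finite.emptyI finite.insertI
        finite_imageI le_trans)
  also have "\<dots> \<le> 2 * card D"
    by (simp add: card_cartesian_product card_insert_if)
  finally show ?thesis .
qed

text \<open>The survival function \<open>G\<close> is antitone, so \<open>{G \<le> \<beta>}\<close> is an up-set of reals and hence a
  countable increasing union of closed half-lines, each of which has mass at most \<open>\<beta>\<close>.\<close>

lemma (in prob_space) survival_superuniform:
  fixes f :: "'a \<Rightarrow> real"
  assumes [measurable]: "f \<in> borel_measurable M" and "0 \<le> \<beta>"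
  shows "prob {x \<in> space M. prob {y \<in> space M. f x \<le> f y} \<le> \<beta>} \<le> \<beta>"
proof -
  define G where "G t = prob {y \<in> space M. t \<le> f y}" for t
  have G_anti: "G t' \<le> G t" if "t \<le> t'" for t t'
    unfolding G_def using that by (intro finite_measure_mono) auto
  define U where "U = {t. G t \<le> \<beta>}"
  have "prob {x \<in> space M. f x \<in> U} \<le> \<beta>"
  proof (cases "\<exists>a\<in>U. \<forall>t\<in>U. a \<le> t")
    case True
    then obtain a where a: "a \<in> U" "\<forall>t\<in>U. a \<le> t"
      by blast
    then have "prob {x \<in> space M. f x \<in> U} \<le> G a"
      unfolding G_def by (intro finite_measure_mono) auto
    with a show ?thesis
      by (simp add: U_def)
  next
    case no_min: False
    obtain q :: "nat \<Rightarrow> real" where q: "range q = \<rat>"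
      using countable_rat by (metis Rats_0 empty_iff uncountable_def)
    have U_less: "\<exists>m. q m \<in> U \<and> q m \<le> t" if t: "t \<in> U" for t
    proof -
      obtain t' where "t' \<in> U" "t' < t"
        using no_min t by (metis linorder_not_le)
      moreover obtain r where "r \<in> \<rat>" "t' < r" "r < t"
        using Rats_dense_in_real[OF \<open>t' < t\<close>] by blast
      moreover obtain m where "q m = r"
        using q \<open>r \<in> \<rat>\<close> by (metis imageE)
      ultimately show ?thesis
        using G_anti[of t' r] unfolding U_def by (intro exI[of _ m]) auto
    qed
    define A where "A m = {x \<in> space M. \<exists>i\<le>m. q i \<in> U \<and> q i \<le> f x}" for m
    have A_sets [measurable]: "A m \<in> sets M" for m
      unfolding A_def by measurable
    have A_le: "prob (A m) \<le> \<beta>" for m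
    \<comment> \<open>At a finite stage only finitely many rationals compete, so the event is a
      half-line event starting at the least of them, which lies in \<open>U\<close>.\<close>
    proof (cases "\<exists>i\<le>m. q i \<in> U")
      case True
      define Q where "Q = {q i | i. i \<le> m \<and> q i \<in> U}"
      have Q: "finite Q" "Q \<noteq> {}"
        using True unfolding Q_def by auto
      have "prob (A m) \<le> G (Min Q)"
        unfolding G_def A_def
        by (intro finite_measure_mono)
           (auto intro!: Min_le_iff[OF Q, THEN iffD2], auto simp: Q_def)
      also have "Min Q \<in> U"
        using Min_in[OF Q] by (auto simp: Q_def)
      then have "G (Min Q) \<le> \<beta>"
        by (simp add: U_def)
      finally show ?thesis .
    next
      case False
      then have "A m = {}"
        by (auto simp: A_def)
      then show ?thesis
        using assms(2) by simp
    qed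
    have "incseq A"
      by (auto simp: incseq_def A_def) (meson order.trans)
    then have lim: "(\<lambda>m. prob (A m)) \<longlonglongrightarrow> prob (\<Union>m. A m)"
      by (intro finite_Lim_measure_incseq) auto
    have "prob {x \<in> space M. f x \<in> U} \<le> prob (\<Union>m. A m)"
      using U_less by (intro finite_measure_mono) (auto simp: A_def, meson order_refl)
    also have "\<dots> \<le> \<beta>"
      using lim A_le by (meson LIMSEQ_le_const2)
    finally show ?thesis .
  qed
  then show ?thesis
    by (simp add: U_def G_def)
qed

text \<open>The product rule on rectangles determines the joint law. Independence is required of set
  systems, not of variables, so that \<open>f\<close> and \<open>g\<close> may have different types
  and \<open>f\<close> may be the identity into a smaller sigma-algebra.\<close>

lemma (in prob_space) distr_pair_indep_set:
  assumes indep: "indep_set A B"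
    and [measurable]: "f \<in> M \<rightarrow>\<^sub>M S" "g \<in> M \<rightarrow>\<^sub>M T"
    and f: "\<And>C. C \<in> sets S \<Longrightarrow> f -` C \<inter> space M \<in> A"
    and g: "\<And>C. C \<in> sets T \<Longrightarrow> g -` C \<inter> space M \<in> B"
  shows "distr M S f \<Otimes>\<^sub>M distr M T g = distr M (S \<Otimes>\<^sub>M T) (\<lambda>x. (f x, g x))"
proof (rule pair_measure_eqI)
  interpret f: prob_space "distr M S f"
    by (rule prob_space_distr) simp
  interpret g: prob_space "distr M T g"
    by (rule prob_space_distr) simp
  show "sigma_finite_measure (distr M S f)" "sigma_finite_measure (distr M T g)"
    by unfold_locales
  fix C D assume "C \<in> sets (distr M S f)" "D \<in> sets (distr M T g)"
  then have [measurable]: "C \<in> sets S" "D \<in> sets T"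
    by simp_all
  have "(\<lambda>x. (f x, g x)) -` (C \<times> D) \<inter> space M = (f -` C \<inter> space M) \<inter> (g -` D \<inter> space M)"
    by auto
  then show "emeasure (distr M S f) C * emeasure (distr M T g) D =
      emeasure (distr M (S \<Otimes>\<^sub>M T) (\<lambda>x. (f x, g x))) (C \<times> D)"
    using indep_setD[OF indep f[of C] g[of D]]
    by (simp add: emeasure_distr emeasure_eq_measure ennreal_mult)
qed simp

text \<open>This replaces conditional expectations given \<open>F\<close>.\<close>

lemma (in prob_space) integral_freeze:
  fixes \<Phi> :: "'a \<times> 'b \<Rightarrow> real"
  assumes indep: "indep_set (sets F) (sets F')" and space: "space F = space M" "space F' = space M"
    and b: "b \<in> F' \<rightarrow>\<^sub>M N" and [measurable]: "\<Phi> \<in> borel_measurable (F \<Otimes>\<^sub>M N)"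
    and bound: "\<And>z. z \<in> space (F \<Otimes>\<^sub>M N) \<Longrightarrow> \<bar>\<Phi> z\<bar> \<le> K"
  shows "(\<integral>x. \<Phi> (x, b x) \<partial>M) = (\<integral>x. (\<integral>y. \<Phi> (x, y) \<partial>distr M N b) \<partial>M)"
proof -
  have F: "x \<inter> space M = x" if "x \<in> sets F" for x
    using sets.sets_into_space[OF that] space by auto
  have b': "b -` C \<inter> space M \<in> sets F'" if "C \<in> sets N" for C
    using measurable_sets[OF b that] space by simp
  have [measurable]: "(\<lambda>x. x) \<in> M \<rightarrow>\<^sub>M F"
    using indep_setD_ev1[OF indep] space F by (intro measurableI) auto
  have [measurable]: "b \<in> M \<rightarrow>\<^sub>M N"
    using indep_setD_ev2[OF indep] b' measurable_space[OF b] space by (intro measurableI) auto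
  interpret F: prob_space "distr M F (\<lambda>x. x)"
    by (rule prob_space_distr) simp
  interpret N: prob_space "distr M N b"
    by (rule prob_space_distr) simp
  interpret P: pair_prob_space "distr M F (\<lambda>x. x)" "distr M N b"
    by standard
  have joint: "distr M F (\<lambda>x. x) \<Otimes>\<^sub>M distr M N b = distr M (F \<Otimes>\<^sub>M N) (\<lambda>x. (x, b x))"
    by (rule distr_pair_indep_set[OF indep]) (simp_all add: F b')
  have "(\<integral>x. \<Phi> (x, b x) \<partial>M) = (\<integral>z. \<Phi> z \<partial>distr M (F \<Otimes>\<^sub>M N) (\<lambda>x. (x, b x)))"
    by (subst integral_distr) auto
  also have "\<dots> = (\<integral>z. \<Phi> z \<partial>(distr M F (\<lambda>x. x) \<Otimes>\<^sub>M distr M N b))"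
    by (simp add: joint)
  also have "\<dots> = (\<integral>x. (\<integral>y. \<Phi> (x, y) \<partial>distr M N b) \<partial>distr M F (\<lambda>x. x))"
  proof (rule P.integral_fst'[symmetric])
    show "integrable (distr M F (\<lambda>x. x) \<Otimes>\<^sub>M distr M N b) \<Phi>"
      by (rule P.integrable_const_bound[of _ K])
         (auto intro!: AE_I2 bound simp: space_pair_measure)
  qed
  also have "\<dots> = (\<integral>x. (\<integral>y. \<Phi> (x, y) \<partial>distr M N b) \<partial>M)"
    by (subst integral_distr) auto
  finally show ?thesis .
qed

lemma Int_stable_vimage: "Int_stable {f -` A \<inter> S | A. A \<in> sets N}"
proof (rule Int_stableI)
  fix C D assume "C \<in> {f -` A \<inter> S | A. A \<in> sets N}" "D \<in> {f -` A \<inter> S | A. A \<in> sets N}"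
  then obtain A B where "C = f -` A \<inter> S" "D = f -` B \<inter> S" "A \<in> sets N" "B \<in> sets N"
    by blast
  then have "C \<inter> D = f -` (A \<inter> B) \<inter> S" "A \<inter> B \<in> sets N"
    by auto
  then show "C \<inter> D \<in> {f -` A \<inter> S | A. A \<in> sets N}"
    by blast
qed

lemma integral_uniform_le:
  fixes p :: real
  assumes "0 \<le> p" "p \<le> 1"
  shows "(\<integral>y. of_bool (y \<le> p) \<partial>uniform_measure lborel {0..1}) = p"
proof -
  have "(\<integral>y. of_bool (y \<le> p) \<partial>uniform_measure lborel {0..1::real}) =
      (\<integral>y. indicator {..p} y \<partial>uniform_measure lborel {0..1})"
    by (intro Bochner_Integration.integral_cong) (auto simp: indicator_def)
  also have "\<dots> = measure (uniform_measure lborel {0..1}) {..p}"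
    by simp
  also have "\<dots> = measure lborel ({0..1} \<inter> {..p}) / measure lborel {0..1::real}"
    by (rule measure_uniform_measure) auto
  also have "{0..1} \<inter> {..p} = {0..p}"
    using assms by auto
  finally show ?thesis
    using assms by simp
qed

lemma young_le:
  fixes a d t :: real
  assumes "0 < t"
  shows "a * d \<le> (t * a\<^sup>2 + d\<^sup>2 / t) / 2"
proof -
  have "0 \<le> (t * a - d)\<^sup>2 / t"
    using assms by simp
  also have "(t * a - d)\<^sup>2 / t = t * a\<^sup>2 + d\<^sup>2 / t - 2 * (a * d)"
    using assms by (simp add: power2_eq_square field_simps)
  finally show ?thesis
    by simp
qed

lemma eventually_along_evenI:
  "eventually P sequentially \<Longrightarrow> eventually P along_even"
  unfolding along_even_def by (rule filter_leD[OF inf_le1])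

lemma eventually_even_along_even: "eventually even along_even"
  unfolding along_even_def eventually_inf_principal by simp

lemma choose_half_ge:
  assumes "even n" "4 \<le> n"
  shows "(real n)\<^sup>2 / 16 \<le> real (n div 2 choose 2)"
proof -
  obtain m where m: "n = 2 * m"
    using assms(1) by (rule evenE)
  with assms(2) have "2 \<le> m"
    by simp
  have "real (m choose 2) = real m * (real m - 1) / 2"
    using \<open>2 \<le> m\<close> by (simp add: choose_two real_of_nat_div of_nat_diff)
  \<comment> \<open>From \<open>2 \<le> m\<close> follows m <= 2 (m - 1), so m (m - 1) / 2 is at
    least m^2 / 4, which is n^2 / 16.\<close>
  moreover have "real m * real m \<le> real m * (2 * (real m - 1))"
    using \<open>2 \<le> m\<close> by (intro mult_left_mono) auto
  ultimately have "real m * real m / 4 \<le> real (m choose 2)"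
    by (simp add: algebra_simps)
  then show ?thesis
    by (simp add: m power2_eq_square)
qed

section \<open>Sources of randomness\<close>

context dyadic_regression
begin

abbreviation node_space :: "('x \<times> real \<times> 'z) measure"
  where "node_space \<equiv> MX \<Otimes>\<^sub>M unit_interval \<Otimes>\<^sub>M MZ"

definition node :: "nat \<Rightarrow> 'a \<Rightarrow> 'x \<times> real \<times> 'z"
  where "node i \<omega> = (X i \<omega>, \<xi> i \<omega>, \<zeta> i \<omega>)"

definition sources :: "nat set \<Rightarrow> source set"
  where "sources D = Node ` D \<union> Eta ` pairs D \<union> Nu ` pairs D"

definition source_sets :: "source \<Rightarrow> 'a set set"
  where "source_sets a = (case a of
            Node i \<Rightarrow> {node i -` A \<inter> space \<Omega> | A. A \<in> sets node_space}
          | Eta p \<Rightarrow> {\<eta> p -` A \<inter> space \<Omega> | A. A \<in> sets borel}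
          | Nu p \<Rightarrow> {\<nu> p -` A \<inter> space \<Omega> | A. A \<in> sets MV})"

text \<open>Only the space and the events of this measure matter; the encoding lets dependence on a
  set of sources be stated as measurability.\<close>

definition sig :: "source set \<Rightarrow> 'a measure"
  where "sig A = sigma (space \<Omega>) (\<Union>a\<in>A. source_sets a)"

lemma indep_sources: "indep_sets source_sets (sources {1..n})"
  using indep unfolding sources_def source_sets_def[abs_def] node_def[abs_def] .

lemma source_sets_space: "source_sets a \<subseteq> Pow (space \<Omega>)"
  by (auto simp: source_sets_def split: source.splits)

lemma space_sig [simp]: "space (sig A) = space \<Omega>"
  by (simp add: sig_def space_measure_of_conv)

lemma sets_sig: "sets (sig A) = sigma_sets (space \<Omega>) (\<Union>a\<in>A. source_sets a)"
  unfolding sig_def using source_sets_space by (intro sets_measure_of) blast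

lemma sets_sig_mono: "A \<subseteq> B \<Longrightarrow> sets (sig A) \<subseteq> sets (sig B)"
  unfolding sets_sig by (intro sigma_sets_mono') blast

lemma sets_sig_subset: "A \<subseteq> sources {1..n} \<Longrightarrow> sets (sig A) \<subseteq> events"
  unfolding sets_sig using indep_sources
  by (intro sets.sigma_sets_subset) (auto simp: indep_sets_def)

lemma measurable_ident_sig:
  assumes "A \<subseteq> sources {1..n}" shows "(\<lambda>\<omega>. \<omega>) \<in> \<Omega> \<rightarrow>\<^sub>M sig A"
proof (rule measurableI)
  fix C assume "C \<in> sets (sig A)"
  then have "C \<in> events"
    using sets_sig_subset[OF assms] by blast
  then show "(\<lambda>\<omega>. \<omega>) -` C \<inter> space \<Omega> \<in> events"
    by simp
qed simp

lemma measurable_ident_sig_mono: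
  assumes "B \<subseteq> A" shows "(\<lambda>\<omega>. \<omega>) \<in> sig A \<rightarrow>\<^sub>M sig B"
proof (rule measurableI)
  fix C assume "C \<in> sets (sig B)"
  then have "C \<in> sets (sig A)"
    using sets_sig_mono[OF assms] by blast
  then show "(\<lambda>\<omega>. \<omega>) -` C \<inter> space (sig A) \<in> sets (sig A)"
    by (simp del: space_sig)
qed simp

lemma measurable_sig_mono: "f \<in> sig B \<rightarrow>\<^sub>M N \<Longrightarrow> B \<subseteq> A \<Longrightarrow> f \<in> sig A \<rightarrow>\<^sub>M N"
  using measurable_compose[OF measurable_ident_sig_mono] .

lemma measurable_sig_random: "f \<in> sig A \<rightarrow>\<^sub>M N \<Longrightarrow> A \<subseteq> sources {1..n} \<Longrightarrow> f \<in> \<Omega> \<rightarrow>\<^sub>M N"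
  using measurable_compose[OF measurable_ident_sig] .

lemma source_sets_sig: "a \<in> A \<Longrightarrow> B \<in> source_sets a \<Longrightarrow> B \<in> sets (sig A)"
  unfolding sets_sig by (intro sigma_sets.Basic) blast

lemma node_measurable_sig:
  assumes "Node i \<in> A" "A \<subseteq> sources {1..n}"
  shows "node i \<in> sig A \<rightarrow>\<^sub>M node_space"
proof (rule measurableI)
  have "i \<in> {1..n}"
    using assms by (auto simp: sources_def)
  from nodes_measurable[OF this] show "\<omega> \<in> space (sig A) \<Longrightarrow> node i \<omega> \<in> space node_space" for \<omega>
    by (auto simp: node_def[abs_def] dest: measurable_space)
  show "B \<in> sets node_space \<Longrightarrow> node i -` B \<inter> space (sig A) \<in> sets (sig A)" for B
    using assms(1) by (intro source_sets_sig[of "Node i"]) (auto simp: source_sets_def)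
qed

lemma eta_measurable_sig:
  assumes "Eta p \<in> A"
  shows "\<eta> p \<in> borel_measurable (sig A)"
proof (rule measurableI)
  show "B \<in> sets borel \<Longrightarrow> \<eta> p -` B \<inter> space (sig A) \<in> sets (sig A)" for B
    using assms by (intro source_sets_sig[of "Eta p"]) (auto simp: source_sets_def)
qed simp

lemma nu_measurable_sig:
  assumes "Nu p \<in> A" "A \<subseteq> sources {1..n}"
  shows "\<nu> p \<in> sig A \<rightarrow>\<^sub>M MV"
proof (rule measurableI)
  have "p \<in> pairs {1..n}"
    using assms by (auto simp: sources_def)
  from nu_measurable[OF this] show "\<omega> \<in> space (sig A) \<Longrightarrow> \<nu> p \<omega> \<in> space MV" for \<omega>
    by (auto dest: measurable_space)
  show "B \<in> sets MV \<Longrightarrow> \<nu> p -` B \<inter> space (sig A) \<in> sets (sig A)" for B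
    using assms(1) by (intro source_sets_sig[of "Nu p"]) (auto simp: source_sets_def)
qed

lemma source_sets_Int_stable: "Int_stable (source_sets a)"
  by (cases a) (simp_all add: source_sets_def Int_stable_vimage)

text \<open>Grouping an independent family of intersection-stable generators into two disjoint
  blocks keeps independence. All later independence claims thereby reduce to disjointness of sets of
  sources.\<close>

lemma indep_set_sig:
  assumes "A \<subseteq> sources {1..n}" "B \<subseteq> sources {1..n}" "A \<inter> B = {}"
  shows "indep_set (sets (sig A)) (sets (sig B))"
proof -
  have "indep_sets (\<lambda>j. sigma_sets (space \<Omega>) (\<Union>a\<in>case_bool A B j. source_sets a)) UNIV"
  proof (rule indep_sets_collect_sigma)
    show "indep_sets source_sets (\<Union>j. case_bool A B j)"
      using assms by (intro indep_sets_mono_index[OF _ indep_sources]) (auto split: bool.splits)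
    show "disjoint_family (case_bool A B)"
      using assms(3) by (auto simp: disjoint_family_on_def split: bool.splits)
  qed (rule source_sets_Int_stable)
  also have "(\<lambda>j. sigma_sets (space \<Omega>) (\<Union>a\<in>case_bool A B j. source_sets a)) =
      case_bool (sets (sig A)) (sets (sig B))"
    by (auto simp: fun_eq_iff sets_sig split: bool.splits)
  finally show ?thesis
    by (simp add: indep_set_def)
qed

lemma distr_pair_sig:
  assumes "A \<subseteq> sources {1..n}" "B \<subseteq> sources {1..n}" "A \<inter> B = {}"
    and a: "a \<in> sig A \<rightarrow>\<^sub>M S" and b: "b \<in> sig B \<rightarrow>\<^sub>M T"
  shows "distr \<Omega> S a \<Otimes>\<^sub>M distr \<Omega> T b = distr \<Omega> (S \<Otimes>\<^sub>M T) (\<lambda>x. (a x, b x))"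
  using measurable_sets[OF a] measurable_sets[OF b]
  by (intro distr_pair_indep_set[OF indep_set_sig[OF assms(1-3)]] measurable_sig_random[OF a]
      measurable_sig_random[OF b]) (use assms in auto)

lemma integral_freeze_sig:
  fixes \<Phi> :: "'a \<times> 'b \<Rightarrow> real"
  assumes "A \<subseteq> sources {1..n}" "B \<subseteq> sources {1..n}" "A \<inter> B = {}"
    and "b \<in> sig B \<rightarrow>\<^sub>M N" "\<Phi> \<in> borel_measurable (sig A \<Otimes>\<^sub>M N)"
    and "\<And>z. z \<in> space (sig A \<Otimes>\<^sub>M N) \<Longrightarrow> \<bar>\<Phi> z\<bar> \<le> K"
  shows "(\<integral>\<omega>. \<Phi> (\<omega>, b \<omega>) \<partial>\<Omega>) = (\<integral>\<omega>. (\<integral>y. \<Phi> (\<omega>, y) \<partial>distr \<Omega> N b) \<partial>\<Omega>)"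
  using assms by (intro integral_freeze[OF indep_set_sig[OF assms(1-3)]]) auto

text \<open>The randomness that determines the score of a pair. The noise \<open>\<eta>\<close> is
  left out because it decides observation only and is integrated out separately.\<close>

definition edge_block :: "nat \<times> nat \<Rightarrow> 'a \<Rightarrow> ('x \<times> real \<times> 'z) \<times> ('x \<times> real \<times> 'z) \<times> 'v"
  where "edge_block e \<omega> = (node (fst e) \<omega>, node (snd e) \<omega>, \<nu> e \<omega>)"

definition edge_sources :: "nat \<times> nat \<Rightarrow> source set"
  where "edge_sources e = {Node (fst e), Node (snd e), Nu e}"

abbreviation edge_space
  where "edge_space \<equiv> node_space \<Otimes>\<^sub>M node_space \<Otimes>\<^sub>M MV"

definition edge_law :: "(('x \<times> real \<times> 'z) \<times> ('x \<times> real \<times> 'z) \<times> 'v) measure"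
  where "edge_law = LV \<Otimes>\<^sub>M LV \<Otimes>\<^sub>M LN"

lemma edge_sources_subset: "e \<in> pairs {1..n} \<Longrightarrow> edge_sources e \<subseteq> sources {1..n}"
  by (auto simp: edge_sources_def sources_def pairs_def)

lemma edge_block_measurable_sig:
  assumes "edge_sources e \<subseteq> A" "A \<subseteq> sources {1..n}"
  shows "edge_block e \<in> sig A \<rightarrow>\<^sub>M edge_space"
  using assms unfolding edge_block_def[abs_def]
  by (intro measurable_Pair node_measurable_sig nu_measurable_sig) (auto simp: edge_sources_def)

text \<open>The form in which exchangeability is used: test pair and calibration pairs have blocks
  of one common law, so one survival function serves both.\<close>

lemma edge_block_law:
  assumes e: "e \<in> pairs {1..n}"
  shows "distr \<Omega> edge_space (edge_block e) = edge_law"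
proof -
  have ij: "fst e \<in> {1..n}" "snd e \<in> {1..n}" "fst e < snd e"
    using e by (auto simp: pairs_def)
  have "distr \<Omega> node_space (node (snd e)) \<Otimes>\<^sub>M distr \<Omega> MV (\<nu> e) =
      distr \<Omega> (node_space \<Otimes>\<^sub>M MV) (\<lambda>\<omega>. (node (snd e) \<omega>, \<nu> e \<omega>))"
    using e ij by (intro distr_pair_sig[where A = "{Node (snd e)}" and B = "{Nu e}"]
        node_measurable_sig nu_measurable_sig) (auto simp: sources_def)
  then have 1: "distr \<Omega> (node_space \<Otimes>\<^sub>M MV) (\<lambda>\<omega>. (node (snd e) \<omega>, \<nu> e \<omega>)) = LV \<Otimes>\<^sub>M LN"
    using nodes_law[OF ij(2)] nu_law[OF e] by (simp add: node_def[abs_def])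
  have "distr \<Omega> node_space (node (fst e)) \<Otimes>\<^sub>M
        distr \<Omega> (node_space \<Otimes>\<^sub>M MV) (\<lambda>\<omega>. (node (snd e) \<omega>, \<nu> e \<omega>)) =
      distr \<Omega> edge_space (\<lambda>\<omega>. (node (fst e) \<omega>, node (snd e) \<omega>, \<nu> e \<omega>))"
    using e ij by (intro distr_pair_sig[where A = "{Node (fst e)}" and B = "{Node (snd e), Nu e}"]
        node_measurable_sig nu_measurable_sig measurable_Pair) (auto simp: sources_def)
  then show ?thesis
    using nodes_law[OF ij(1)] unfolding 1 by (simp add: node_def[abs_def] edge_law_def edge_block_def[abs_def])
qed

section \<open>Measurability of the model variables and of the observed data in terms of
  sources\<close>

lemma X_measurable_sig:
  assumes "Node i \<in> A" "A \<subseteq> sources {1..n}"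
  shows "X i \<in> sig A \<rightarrow>\<^sub>M MX"
proof -
  have "(\<lambda>\<omega>. fst (node i \<omega>)) \<in> sig A \<rightarrow>\<^sub>M MX"
    using node_measurable_sig[OF assms] by measurable
  then show ?thesis
    by (simp add: node_def)
qed

lemma xi_measurable_sig:
  assumes "Node i \<in> A" "A \<subseteq> sources {1..n}"
  shows "\<xi> i \<in> sig A \<rightarrow>\<^sub>M unit_interval"
proof -
  have "(\<lambda>\<omega>. fst (snd (node i \<omega>))) \<in> sig A \<rightarrow>\<^sub>M unit_interval"
    using node_measurable_sig[OF assms] by measurable
  then show ?thesis
    by (simp add: node_def)
qed

lemma zeta_measurable_sig:
  assumes "Node i \<in> A" "A \<subseteq> sources {1..n}"
  shows "\<zeta> i \<in> sig A \<rightarrow>\<^sub>M MZ"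
proof -
  have "(\<lambda>\<omega>. snd (snd (node i \<omega>))) \<in> sig A \<rightarrow>\<^sub>M MZ"
    using node_measurable_sig[OF assms] by measurable
  then show ?thesis
    by (simp add: node_def)
qed

lemma xi_unit: "i \<in> {1..n} \<Longrightarrow> \<omega> \<in> space \<Omega> \<Longrightarrow> \<xi> i \<omega> \<in> {0..1}"
  using measurable_space[OF nodes_measurable, of i \<omega>]
  by (auto simp: space_pair_measure space_restrict_space)

text \<open>The truncation at 1 is omitted; it is inactive once \<open>\<rho> * C \<le> 1\<close>,
  as the locale below assumes.\<close>

definition edge_prob :: "nat \<times> nat \<Rightarrow> 'a \<Rightarrow> real"
  where "edge_prob e \<omega> = \<rho> * w (\<xi> (fst e) \<omega>) (\<xi> (snd e) \<omega>)"

text \<open>Stated for the two nodes alone because the Frobenius norm also runs over the diagonal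
  and over decreasing index pairs, to which no edge noise belongs.\<close>

lemma edge_prob_measurable_nodes:
  assumes "Node (fst e) \<in> A" "Node (snd e) \<in> A" "A \<subseteq> sources {1..n}"
  shows "edge_prob e \<in> borel_measurable (sig A)"
proof -
  have "(\<lambda>\<omega>. (\<xi> (fst e) \<omega>, \<xi> (snd e) \<omega>)) \<in> sig A \<rightarrow>\<^sub>M unit_interval \<Otimes>\<^sub>M unit_interval"
    using assms by (intro measurable_Pair xi_measurable_sig) auto
  moreover have "(\<lambda>(u, v). w u v) \<in> borel_measurable (unit_interval \<Otimes>\<^sub>M unit_interval)"
    using graphon by (simp add: normalized_graphon_def)
  ultimately have "(\<lambda>\<omega>. (\<lambda>(u, v). w u v) (\<xi> (fst e) \<omega>, \<xi> (snd e) \<omega>)) \<in> borel_measurable (sig A)"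
    by (rule measurable_compose)
  then show ?thesis
    unfolding edge_prob_def[abs_def] by simp
qed

lemma edge_prob_measurable_sig:
  assumes "edge_sources e \<subseteq> A" "A \<subseteq> sources {1..n}"
  shows "edge_prob e \<in> borel_measurable (sig A)"
  using assms by (intro edge_prob_measurable_nodes) (auto simp: edge_sources_def)

lemma M_measurable_sig:
  assumes e: "(i, j) \<in> pairs {1..n}"
    and A: "insert (Eta (i, j)) (edge_sources (i, j)) \<subseteq> A" "A \<subseteq> sources {1..n}"
  shows "M i j \<in> borel_measurable (sig A)"
proof -
  have [measurable]: "edge_prob (i, j) \<in> borel_measurable (sig A)" "\<eta> (i, j) \<in> borel_measurable (sig A)"
    using A by (auto intro!: edge_prob_measurable_sig eta_measurable_sig)
  have "(\<lambda>\<omega>. of_bool (\<eta> (i, j) \<omega> \<le> min (edge_prob (i, j) \<omega>) 1)) \<in> borel_measurable (sig A)"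
    by measurable
  then show ?thesis
    using e M_eq by (subst measurable_cong) (auto simp: edge_prob_def)
qed

lemma Y_measurable_sig:
  assumes e: "(i, j) \<in> pairs {1..n}"
    and A: "edge_sources (i, j) \<subseteq> A" "A \<subseteq> sources {1..n}"
  shows "Y i j \<in> sig A \<rightarrow>\<^sub>M MY"
proof -
  have "(\<lambda>\<omega>. g (X i \<omega>, \<zeta> i \<omega>, X j \<omega>, \<zeta> j \<omega>, \<nu> (i, j) \<omega>)) \<in> sig A \<rightarrow>\<^sub>M MY"
    using A by (intro measurable_compose[OF _ g_measurable] measurable_Pair X_measurable_sig
        zeta_measurable_sig nu_measurable_sig) (auto simp: edge_sources_def)
  then show ?thesis
    using e Y_eq by (subst measurable_cong) auto
qed

lemma edge_sources_sources:
  "e \<in> pairs D \<Longrightarrow> insert (Eta e) (edge_sources e) \<subseteq> sources D"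
  by (auto simp: edge_sources_def sources_def pairs_def)

lemma sources_mono: "D \<subseteq> D' \<Longrightarrow> sources D \<subseteq> sources D'"
  using pairs_mono[of D D'] by (auto simp: sources_def)

text \<open>Measurability of the identity expresses that one sigma-algebra contains the other, in a
  form that composes with the fitted functions. It is enough to check the generators of the observed
  data.\<close>

lemma measurable_ident_observed_data:
  assumes D: "D \<subseteq> {1..n}" and A: "sources D \<subseteq> A" "A \<subseteq> sources {1..n}"
  shows "(\<lambda>\<omega>. \<omega>) \<in> sig A \<rightarrow>\<^sub>M observed_data \<Omega> MX MY X Y M D"
  unfolding observed_data_def
proof (rule measurable_measure_of)
  let ?G = "{{\<omega> \<in> space \<Omega>. X i \<omega> \<in> B} | i B. i \<in> D \<and> B \<in> sets MX} \<union>
     {{\<omega> \<in> space \<Omega>. M i j \<omega> = 1} | i j. (i, j) \<in> pairs D} \<union>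
     {{\<omega> \<in> space \<Omega>. M i j \<omega> = 1 \<and> Y i j \<omega> \<in> B} | i j B. (i, j) \<in> pairs D \<and> B \<in> sets MY}"
  have X: "{\<omega> \<in> space (sig A). X i \<omega> \<in> B} \<in> sets (sig A)" if "i \<in> D" "B \<in> sets MX" for i B
    using that A by (intro measurable_sets_Collect[OF X_measurable_sig]) (auto simp: sources_def)
  have M: "{\<omega> \<in> space (sig A). M i j \<omega> = 1} \<in> sets (sig A)" if "(i, j) \<in> pairs D" for i j
    using that A edge_sources_sources[OF that] pairs_mono[OF D]
    by (intro borel_measurable_eq M_measurable_sig) (auto simp del: space_sig)
  have Y: "{\<omega> \<in> space (sig A). Y i j \<omega> \<in> B} \<in> sets (sig A)" if "(i, j) \<in> pairs D" "B \<in> sets MY" for i j B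
    using that A edge_sources_sources[OF that(1)] pairs_mono[OF D]
    by (intro measurable_sets_Collect[OF Y_measurable_sig]) auto
  have G: "?G \<subseteq> sets (sig A)"
    using X M Y sets.sets_Collect_conj[of "sig A"] by (auto simp: sets.sets_Collect_conj)
  show "(\<lambda>\<omega>. \<omega>) -` B \<inter> space (sig A) \<in> sets (sig A)" if "B \<in> ?G" for B
    unfolding vimage_ident by (rule sets.Int[OF subsetD[OF G that] sets.top])
  show "?G \<subseteq> Pow (space \<Omega>)"
    by auto
qed auto

lemma observed_data_measurable_sig:
  assumes "f \<in> observed_data \<Omega> MX MY X Y M D \<rightarrow>\<^sub>M N"
    and "D \<subseteq> {1..n}" "sources D \<subseteq> A" "A \<subseteq> sources {1..n}"
  shows "f \<in> sig A \<rightarrow>\<^sub>M N"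
  using measurable_compose[OF measurable_ident_observed_data assms(1)] assms(2-) .

end

section \<open>Scores and inverse propensity weights\<close>

text \<open>The situation at one fixed \<open>n\<close>. The bound \<open>C\<close> comes from the
  graphon, and \<open>rho_C\<close> is available for large \<open>n\<close> because the density
  tends to 0. The functions \<open>h\<close> and \<open>s\<close> see only the training nodes,
  whereas \<open>p_hat\<close> sees all nodes.\<close>

locale weighted_conformal = dyadic_regression +
  fixes MP and h and s :: "'a \<Rightarrow> _ \<Rightarrow> _ \<Rightarrow> real" and p_hat :: "nat \<Rightarrow> nat \<Rightarrow> 'a \<Rightarrow> real" and k l :: nat and c C :: real
  assumes even_n: "even n"
    and h_trained: "(\<lambda>(\<omega>, x, x'). h \<omega> x x')
        \<in> observed_data \<Omega> MX MY X Y M (D1 n) \<Otimes>\<^sub>M MX \<Otimes>\<^sub>M MX \<rightarrow>\<^sub>M MP"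
    and s_fitted: "(\<lambda>(\<omega>, y, y'). s \<omega> y y')
        \<in> borel_measurable (observed_data \<Omega> MX MY X Y M (D1 n) \<Otimes>\<^sub>M MY \<Otimes>\<^sub>M MP)"
    and p_hat_estimator: "\<And>i j. i \<in> {1..n} \<Longrightarrow> j \<in> {1..n} \<Longrightarrow>
        p_hat i j \<in> borel_measurable (observed_data \<Omega> MX MY X Y M {1..n})"
    and c_pos: "0 < c"
    and w_ge: "\<And>u v. u \<in> {0..1} \<Longrightarrow> v \<in> {0..1} \<Longrightarrow> c \<le> w u v"
    and w_le: "\<And>u v. u \<in> {0..1} \<Longrightarrow> v \<in> {0..1} \<Longrightarrow> w u v \<le> C"
    and p_hat_ge: "AE \<omega> in \<Omega>. \<forall>i\<in>{1..n}. \<forall>j\<in>{1..n}. c \<le> p_hat i j \<omega> / \<rho>"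
    and rho_C: "\<rho> * C \<le> 1"
    and kl_pairs: "(k, l) \<in> pairs (D2 n)"
begin

lemma D_subset: "D1 n \<subseteq> {1..n}" "D2 n \<subseteq> {1..n}"
  by (auto simp: D1_def D2_def)

lemma pairs_D2: "e \<in> pairs (D2 n) \<Longrightarrow> e \<in> pairs {1..n}"
  using pairs_mono[OF D_subset(2)] by blast

lemma sources_D1_disjoint:
  "e \<in> pairs (D2 n) \<Longrightarrow> sources (D1 n) \<inter> insert (Eta e) (edge_sources e) = {}"
  by (auto simp: sources_def edge_sources_def pairs_def D1_def D2_def)

lemma sources_D1_subset: "sources (D1 n) \<subseteq> sources {1..n}"
  by (rule sources_mono[OF D_subset(1)])

lemma edge_prob_bounds:
  assumes "e \<in> pairs {1..n}" "\<omega> \<in> space \<Omega>"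
  shows "c * \<rho> \<le> edge_prob e \<omega>" "edge_prob e \<omega> \<le> C * \<rho>" "0 < edge_prob e \<omega>" "edge_prob e \<omega> \<le> 1"
proof -
  have "fst e \<in> {1..n}" "snd e \<in> {1..n}"
    using assms(1) by (auto simp: pairs_def)
  then have "\<xi> (fst e) \<omega> \<in> {0..1}" "\<xi> (snd e) \<omega> \<in> {0..1}"
    using assms(2) by (blast intro: xi_unit)+
  then have *: "c \<le> w (\<xi> (fst e) \<omega>) (\<xi> (snd e) \<omega>)" "w (\<xi> (fst e) \<omega>) (\<xi> (snd e) \<omega>) \<le> C"
    using w_ge w_le by auto
  with rho_pos show 1: "c * \<rho> \<le> edge_prob e \<omega>" "edge_prob e \<omega> \<le> C * \<rho>"
    by (auto simp: edge_prob_def mult.commute mult_left_mono)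
  have "0 < c * \<rho>"
    using c_pos rho_pos by simp
  with 1 rho_C show "0 < edge_prob e \<omega>" "edge_prob e \<omega> \<le> 1"
    by (auto simp: mult.commute)
qed

text \<open>The outcome \<open>\<omega>\<close> enters only through the fitted functions, while the
  block \<open>b\<close> is a free argument. This separation allows the block to be integrated out
  with the training data frozen.\<close>

definition score where
  "score \<omega> b = (case b of ((x, u :: real, z), (x', u' :: real, z'), v) \<Rightarrow> s \<omega> (g (x, z, x', z', v)) (h \<omega> x x'))"

lemma score_measurable:
  assumes "sources (D1 n) \<subseteq> A" "A \<subseteq> sources {1..n}"
  shows "(\<lambda>(\<omega>, b). score \<omega> b) \<in> borel_measurable (sig A \<Otimes>\<^sub>M edge_space)"
proof -
  have [measurable]: "(\<lambda>\<omega>. \<omega>) \<in> sig A \<rightarrow>\<^sub>M observed_data \<Omega> MX MY X Y M (D1 n)"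
    by (rule measurable_ident_observed_data[OF D_subset(1) assms])
  note [measurable] = g_measurable
  have "(\<lambda>(\<omega>, (x, u, z), (x', u', z'), v). (\<lambda>(\<omega>, x, x'). h \<omega> x x') (\<omega>, x, x'))
      \<in> sig A \<Otimes>\<^sub>M edge_space \<rightarrow>\<^sub>M MP"
    unfolding split_beta' by (rule measurable_compose[OF _ h_trained[unfolded split_beta']]) measurable
  then have [measurable]: "(\<lambda>q. h (fst q) (fst (fst (snd q))) (fst (fst (snd (snd q)))))
      \<in> sig A \<Otimes>\<^sub>M edge_space \<rightarrow>\<^sub>M MP"
    by (simp add: split_beta')
  have "(\<lambda>q. (\<lambda>(\<omega>, y, y'). s \<omega> y y') (fst q, g (fst (fst (snd q)), snd (snd (fst (snd q))),
        fst (fst (snd (snd q))), snd (snd (fst (snd (snd q)))), snd (snd (snd q))),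
        h (fst q) (fst (fst (snd q))) (fst (fst (snd (snd q))))))
      \<in> borel_measurable (sig A \<Otimes>\<^sub>M edge_space)"
    by (rule measurable_compose[OF _ s_fitted]) measurable
  then show ?thesis
    by (simp add: score_def split_beta')
qed

definition edge_score where
  "edge_score e \<omega> = score \<omega> (edge_block e \<omega>)"

lemma edge_score_eq:
  assumes "(i, j) \<in> pairs {1..n}" "\<omega> \<in> space \<Omega>"
  shows "edge_score (i, j) \<omega> = s \<omega> (Y i j \<omega>) (h \<omega> (X i \<omega>) (X j \<omega>))"
  using Y_eq[OF assms] by (simp add: edge_score_def score_def edge_block_def node_def)

lemma edge_score_measurable_sig:
  assumes "sources (D1 n) \<subseteq> A" "edge_sources e \<subseteq> A" "A \<subseteq> sources {1..n}"
  shows "edge_score e \<in> borel_measurable (sig A)"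
proof -
  have [measurable]: "edge_block e \<in> sig A \<rightarrow>\<^sub>M edge_space"
    by (rule edge_block_measurable_sig[OF assms(2,3)])
  have "(\<lambda>\<omega>. (\<lambda>(\<omega>, b). score \<omega> b) (\<omega>, edge_block e \<omega>)) \<in> borel_measurable (sig A)"
    by (rule measurable_compose[OF _ score_measurable[OF assms(1,3)]]) measurable
  then show ?thesis
    unfolding edge_score_def[abs_def] by simp
qed

lemma prob_space_edge_law: "prob_space edge_law"
  unfolding edge_block_law[OF pairs_D2[OF kl_pairs], symmetric]
  using edge_sources_subset[OF pairs_D2[OF kl_pairs]]
  by (intro prob_space_distr measurable_sig_random[OF edge_block_measurable_sig]) auto

lemma sets_edge_law [measurable_cong]: "sets edge_law = sets edge_space"
  using edge_block_law[OF pairs_D2[OF kl_pairs], symmetric] by simp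

text \<open>Written as an integral rather than a probability, so that joint measurability in
  \<open>\<omega>\<close> and \<open>t\<close> follows from that of parametrised integrals.\<close>

definition survival where
  "survival \<omega> t = (\<integral>b. of_bool (t \<le> score \<omega> b) \<partial>edge_law :: real)" for t :: real

lemma survival_bounds: "0 \<le> survival \<omega> t" "survival \<omega> t \<le> 1"
proof -
  interpret L: prob_space edge_law
    by (rule prob_space_edge_law)
  show "0 \<le> survival \<omega> t"
    unfolding survival_def by (intro integral_nonneg_AE) simp
  show "survival \<omega> t \<le> 1"
  \<comment> \<open>For arbitrary \<open>\<omega>\<close> the integrand need not be measurable; a
    non-integrable function has integral 0, so the bound still holds.\<close>
  proof (cases "integrable edge_law (\<lambda>b. of_bool (t \<le> score \<omega> b) :: real)")
    case True
    then show ?thesis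
      unfolding survival_def by (intro L.integral_le_const) auto
  qed (simp add: survival_def not_integrable_integral_eq)
qed

lemma survival_measurable:
  assumes "sources (D1 n) \<subseteq> A" "A \<subseteq> sources {1..n}"
  shows "(\<lambda>(\<omega>, t). survival \<omega> t) \<in> borel_measurable (sig A \<Otimes>\<^sub>M borel)"
proof -
  interpret L: prob_space edge_law
    by (rule prob_space_edge_law)
  have [measurable]: "(\<lambda>q. score (fst (fst q)) (snd q)) \<in> borel_measurable ((sig A \<Otimes>\<^sub>M (borel :: real measure)) \<Otimes>\<^sub>M edge_law)"
    using measurable_compose[OF _ score_measurable[OF assms], of "\<lambda>q. (fst (fst q), snd q)"
        "(sig A \<Otimes>\<^sub>M (borel :: real measure)) \<Otimes>\<^sub>M edge_law"] by simp
  have "(\<lambda>q. \<integral>b. of_bool (snd q \<le> score (fst q) b) \<partial>edge_law :: real) \<in> borel_measurable (sig A \<Otimes>\<^sub>M (borel :: real measure))"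
    by (rule L.borel_measurable_lebesgue_integral) (unfold split_beta', measurable)
  then show ?thesis
    by (simp add: survival_def split_beta')
qed

text \<open>The true propensity is used, and the indicator is expressed through
  \<open>\<eta>\<close> instead of \<open>M\<close>, so that the edge noise can be integrated out
  with everything else fixed.\<close>

definition ipw where
  "ipw e \<omega> = (of_bool (\<eta> e \<omega> \<le> edge_prob e \<omega>) / edge_prob e \<omega> *
    of_bool (edge_score (k, l) \<omega> \<le> edge_score e \<omega>) :: real)"

abbreviation test_survival where
  "test_survival \<omega> \<equiv> survival \<omega> (edge_score (k, l) \<omega>)"

lemma test_survival_measurable_sig:
  assumes "sources (D1 n) \<subseteq> A" "edge_sources (k, l) \<subseteq> A" "A \<subseteq> sources {1..n}"
  shows "(\<lambda>\<omega>. test_survival \<omega>) \<in> borel_measurable (sig A)"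
proof -
  note [measurable] = edge_score_measurable_sig[OF assms]
  have "(\<lambda>\<omega>. (\<lambda>(\<omega>, t). survival \<omega> t) (\<omega>, edge_score (k, l) \<omega>)) \<in> borel_measurable (sig A)"
    by (rule measurable_compose[OF _ survival_measurable[OF assms(1,3)]]) measurable
  then show ?thesis
    by simp
qed

lemma ipw_measurable_sig:
  assumes "sources (D1 n) \<subseteq> A" "edge_sources (k, l) \<subseteq> A" "A \<subseteq> sources {1..n}"
    and "insert (Eta e) (edge_sources e) \<subseteq> A"
  shows "ipw e \<in> borel_measurable (sig A)"
proof -
  note [measurable] = edge_score_measurable_sig[OF assms(1-3)]
  have [measurable]: "edge_score e \<in> borel_measurable (sig A)" "edge_prob e \<in> borel_measurable (sig A)"
      "\<eta> e \<in> borel_measurable (sig A)"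
    using assms by (auto intro!: edge_score_measurable_sig edge_prob_measurable_sig eta_measurable_sig)
  show ?thesis
    unfolding ipw_def[abs_def] by measurable
qed

text \<open>The second bound replaces the random propensity by the constant
  \<open>C * \<rho>\<close> in the threshold. The majorant then depends on \<open>\<eta>\<close>
  alone, and majorants of distinct pairs are independent even if the pairs share a node.\<close>

lemma ipw_bounds:
  assumes "e \<in> pairs {1..n}" "\<omega> \<in> space \<Omega>"
  shows "0 \<le> ipw e \<omega>" "ipw e \<omega> \<le> of_bool (\<eta> e \<omega> \<le> C * \<rho>) / (c * \<rho>)" "ipw e \<omega> \<le> 1 / (c * \<rho>)"
proof -
  note p = edge_prob_bounds[OF assms]
  have cr: "0 < c * \<rho>"
    using c_pos rho_pos by simp
  show "0 \<le> ipw e \<omega>"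
    using p by (simp add: ipw_def)
  have "ipw e \<omega> \<le> of_bool (\<eta> e \<omega> \<le> edge_prob e \<omega>) / edge_prob e \<omega>"
    using p by (auto simp: ipw_def)
  also have "\<dots> \<le> of_bool (\<eta> e \<omega> \<le> C * \<rho>) / (c * \<rho>)"
    using p cr by (intro frac_le) auto
  finally show 1: "ipw e \<omega> \<le> of_bool (\<eta> e \<omega> \<le> C * \<rho>) / (c * \<rho>)" .
  also have "\<dots> \<le> 1 / (c * \<rho>)"
    using cr by (intro divide_right_mono) auto
  finally show "ipw e \<omega> \<le> 1 / (c * \<rho>)" .
qed

lemma survival_eq_prob:
  assumes "\<omega> \<in> space \<Omega>"
  shows "survival \<omega> t = measure edge_law {b \<in> space edge_law. t \<le> score \<omega> b}"
proof -
  have "survival \<omega> t = (\<integral>b. indicator {b. t \<le> score \<omega> b} b \<partial>edge_law)"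
    unfolding survival_def by (intro Bochner_Integration.integral_cong) (auto simp: indicator_def)
  also have "\<dots> = measure edge_law ({b. t \<le> score \<omega> b} \<inter> space edge_law)"
    by (rule Bochner_Integration.integral_indicator)
  finally show ?thesis
    by (simp add: Int_def conj_commute)
qed

lemma score_measurable_edge_law:
  assumes "\<omega> \<in> space \<Omega>"
  shows "score \<omega> \<in> borel_measurable edge_law"
proof -
  have "(\<lambda>b. (\<lambda>(\<omega>, b). score \<omega> b) (\<omega>, b)) \<in> borel_measurable edge_space"
    using assms by (intro measurable_compose[OF measurable_Pair1' score_measurable[OF sources_D1_subset order_refl]]) simp
  then show ?thesis
    by (simp cong: measurable_cong_sets[OF sets_edge_law refl])
qed

text \<open>Training sources and the sources of the test pair are disjoint. With the training data
  frozen, the test block has law \<open>edge_law\<close>, and \<open>survival_superuniform\<close>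
  applies for each fixed outcome.\<close>

lemma prob_test_survival_le:
  assumes "0 \<le> \<beta>"
  shows "prob {\<omega> \<in> space \<Omega>. test_survival \<omega> \<le> \<beta>} \<le> \<beta>"
proof -
  let ?A = "sources (D1 n)" and ?B = "edge_sources (k, l)"
  interpret L: prob_space edge_law
    by (rule prob_space_edge_law)
  note kl = pairs_D2[OF kl_pairs]
  have B: "?B \<subseteq> sources {1..n}"
    by (rule edge_sources_subset[OF kl])
  define \<Phi> where "\<Phi> q = (of_bool (survival (fst q) (score (fst q) (snd q)) \<le> \<beta>) :: real)" for q
  have s [measurable]: "(\<lambda>q. score (fst q) (snd q)) \<in> borel_measurable (sig ?A \<Otimes>\<^sub>M edge_space)"
    using score_measurable[OF order_refl sources_D1_subset] by (simp add: split_beta')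
  have [measurable]: "(\<lambda>q. survival (fst q) (score (fst q) (snd q))) \<in> borel_measurable (sig ?A \<Otimes>\<^sub>M edge_space)"
    using measurable_compose[OF _ survival_measurable[OF order_refl sources_D1_subset],
        of "\<lambda>q. (fst q, score (fst q) (snd q))" "sig ?A \<Otimes>\<^sub>M edge_space"] by simp
  have \<Phi>: "\<Phi> \<in> borel_measurable (sig ?A \<Otimes>\<^sub>M edge_space)"
    unfolding \<Phi>_def[abs_def] by measurable
  have inner: "(\<integral>b. \<Phi> (\<omega>, b) \<partial>edge_law) \<le> \<beta>" if \<omega>: "\<omega> \<in> space \<Omega>" for \<omega>
  proof -
    note [measurable] = score_measurable_edge_law[OF \<omega>]
    have "(\<integral>b. \<Phi> (\<omega>, b) \<partial>edge_law) = (\<integral>b. indicator {b. survival \<omega> (score \<omega> b) \<le> \<beta>} b \<partial>edge_law)"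
      unfolding \<Phi>_def by (intro Bochner_Integration.integral_cong) (auto simp: indicator_def)
    also have "\<dots> = L.prob ({b. survival \<omega> (score \<omega> b) \<le> \<beta>} \<inter> space edge_law)"
      by (rule Bochner_Integration.integral_indicator)
    also have "\<dots> = L.prob {b \<in> space edge_law. L.prob {b' \<in> space edge_law. score \<omega> b \<le> score \<omega> b'} \<le> \<beta>}"
      by (intro arg_cong[where f = L.prob]) (auto simp: survival_eq_prob[OF \<omega>])
    also have "\<dots> \<le> \<beta>"
      using assms by (intro L.survival_superuniform) auto
    finally show ?thesis .
  qed
  have test [measurable]: "(\<lambda>\<omega>. test_survival \<omega>) \<in> borel_measurable \<Omega>"
    by (rule measurable_sig_random[OF test_survival_measurable_sig order_refl])
       (use B sources_D1_subset in auto)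
  have "prob {\<omega> \<in> space \<Omega>. test_survival \<omega> \<le> \<beta>} =
      (\<integral>\<omega>. indicator {\<omega> \<in> space \<Omega>. test_survival \<omega> \<le> \<beta>} \<omega> \<partial>\<Omega>)"
    by simp
  also have "\<dots> = (\<integral>\<omega>. \<Phi> (\<omega>, edge_block (k, l) \<omega>) \<partial>\<Omega>)"
    by (intro Bochner_Integration.integral_cong) (auto simp: \<Phi>_def edge_score_def indicator_def)
  also have "\<dots> = (\<integral>\<omega>. (\<integral>b. \<Phi> (\<omega>, b) \<partial>distr \<Omega> edge_space (edge_block (k, l))) \<partial>\<Omega>)"
    using sources_D1_disjoint[OF kl_pairs]
    by (intro integral_freeze_sig[OF sources_D1_subset B _ _ \<Phi>, where K = 1]
        edge_block_measurable_sig order_refl B) (auto simp: \<Phi>_def)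
  also have "\<dots> = (\<integral>\<omega>. (\<integral>b. \<Phi> (\<omega>, b) \<partial>edge_law) \<partial>\<Omega>)"
    by (simp add: edge_block_law[OF kl])
  also have "\<dots> \<le> (\<integral>\<omega>. \<beta> \<partial>\<Omega>)"
  \<comment> \<open>Without integrability the outer integral is 0 by convention, which is at most
    \<open>\<beta>\<close>.\<close>
  proof (cases "integrable \<Omega> (\<lambda>\<omega>. \<integral>b. \<Phi> (\<omega>, b) \<partial>edge_law)")
    case True
    then show ?thesis
      by (intro integral_mono inner) auto
  qed (use assms in \<open>simp add: not_integrable_integral_eq prob_space\<close>)
  finally show ?thesis
    by (simp add: prob_space)
qed

text \<open>Given everything but \<open>\<eta>\<^sub>e\<close>, the inverse propensity weight has mean one; given everything
  outside the edge \<open>e\<close>, the score of \<open>e\<close> then exceeds that of the test pair with the probability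
  \<open>test_survival\<close>.\<close>

lemma integral_ipw_mult:
  fixes \<Psi> :: "'a \<Rightarrow> real"
  assumes e: "e \<in> pairs (D2 n)" and disj: "edge_sources (k, l) \<inter> insert (Eta e) (edge_sources e) = {}"
    and \<Psi>: "\<Psi> \<in> borel_measurable (sig (sources {1..n} - insert (Eta e) (edge_sources e)))"
    and bound: "\<And>\<omega>. \<omega> \<in> space \<Omega> \<Longrightarrow> \<bar>\<Psi> \<omega>\<bar> \<le> K"
  shows "(\<integral>\<omega>. ipw e \<omega> * \<Psi> \<omega> \<partial>\<Omega>) = (\<integral>\<omega>. test_survival \<omega> * \<Psi> \<omega> \<partial>\<Omega>)"
proof -
  \<comment> \<open>Two levels of freezing: \<open>?A'\<close> omits only the edge noise of
    \<open>e\<close>, while \<open>?A\<close> omits the whole pair. By \<open>disj\<close> the test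
    score is measurable for both.\<close>
  let ?A = "sources {1..n} - insert (Eta e) (edge_sources e)" and ?A' = "sources {1..n} - {Eta e}"
  note e' = pairs_D2[OF e] and kl = pairs_D2[OF kl_pairs]
  have sub: "insert (Eta e) (edge_sources e) \<subseteq> sources {1..n}" "edge_sources (k, l) \<subseteq> sources {1..n}"
    using edge_sources_sources[OF e'] edge_sources_sources[OF kl] by auto
  have A: "sources (D1 n) \<subseteq> ?A" "edge_sources (k, l) \<subseteq> ?A" "?A \<subseteq> sources {1..n}"
    using sources_D1_disjoint[OF e] sources_D1_subset sub disj by auto
  have A': "sources (D1 n) \<subseteq> ?A'" "edge_sources (k, l) \<subseteq> ?A'" "?A' \<subseteq> sources {1..n}" "edge_sources e \<subseteq> ?A'"
    using A sub by (auto simp: edge_sources_def)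
  have K0: "0 \<le> K"
    using bound not_empty by (metis abs_ge_zero all_not_in_conv order_trans)
  have cr: "0 < c * \<rho>"
    using c_pos rho_pos by simp
  define \<Phi>1 where "\<Phi>1 q = of_bool (snd q \<le> edge_prob e (fst q)) / edge_prob e (fst q) *
      (of_bool (edge_score (k, l) (fst q) \<le> edge_score e (fst q)) * \<Psi> (fst q))" for q :: "'a \<times> real"
  have [measurable]: "\<Psi> \<in> borel_measurable (sig ?A')" "edge_prob e \<in> borel_measurable (sig ?A')"
      "edge_score e \<in> borel_measurable (sig ?A')" "edge_score (k, l) \<in> borel_measurable (sig ?A')"
    using A' by (auto intro!: measurable_sig_mono[OF \<Psi>] edge_prob_measurable_sig edge_score_measurable_sig)
  have \<Phi>1: "\<Phi>1 \<in> borel_measurable (sig ?A' \<Otimes>\<^sub>M borel)"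
    unfolding \<Phi>1_def[abs_def] by measurable
  have "(\<integral>\<omega>. ipw e \<omega> * \<Psi> \<omega> \<partial>\<Omega>) = (\<integral>\<omega>. \<Phi>1 (\<omega>, \<eta> e \<omega>) \<partial>\<Omega>)"
    by (simp add: ipw_def \<Phi>1_def mult.assoc)
  also have "\<dots> = (\<integral>\<omega>. (\<integral>y. \<Phi>1 (\<omega>, y) \<partial>distr \<Omega> borel (\<eta> e)) \<partial>\<Omega>)"
  proof (rule integral_freeze_sig[where A = ?A' and B = "{Eta e}" and K = "1 / (c * \<rho>) * K"])
    show "\<eta> e \<in> borel_measurable (sig {Eta e})"
      by (rule eta_measurable_sig) simp
    fix z assume "z \<in> space (sig ?A' \<Otimes>\<^sub>M (borel :: real measure))"
    then have z: "fst z \<in> space \<Omega>"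
      by (auto simp: space_pair_measure)
    note p = edge_prob_bounds[OF e' z]
    have "\<bar>of_bool (snd z \<le> edge_prob e (fst z)) / edge_prob e (fst z)\<bar> \<le> 1 / (c * \<rho>)"
      using p cr by (auto simp: frac_le)
    moreover have "\<bar>of_bool (edge_score (k, l) (fst z) \<le> edge_score e (fst z)) * \<Psi> (fst z)\<bar> \<le> K"
      using bound[OF z] K0 by auto
    ultimately show "\<bar>\<Phi>1 z\<bar> \<le> 1 / (c * \<rho>) * K"
      unfolding \<Phi>1_def abs_mult[of "_ / _"] using cr by (intro mult_mono) auto
  qed (use sub \<Phi>1 in auto)
  also have "\<dots> = (\<integral>\<omega>. of_bool (edge_score (k, l) \<omega> \<le> edge_score e \<omega>) * \<Psi> \<omega> \<partial>\<Omega>)"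
  proof (rule Bochner_Integration.integral_cong[OF refl])
    fix \<omega> assume \<omega>: "\<omega> \<in> space \<Omega>"
    note p = edge_prob_bounds[OF e' \<omega>]
    have "(\<integral>y. \<Phi>1 (\<omega>, y) \<partial>distr \<Omega> borel (\<eta> e)) =
        (\<integral>y. of_bool (y \<le> edge_prob e \<omega>) \<partial>uniform_measure lborel {0..1}) *
        (1 / edge_prob e \<omega> * (of_bool (edge_score (k, l) \<omega> \<le> edge_score e \<omega>) * \<Psi> \<omega>))"
      unfolding eta_law[OF e'] integral_mult_left_zero[symmetric] by (simp add: \<Phi>1_def)
    also have "\<dots> = of_bool (edge_score (k, l) \<omega> \<le> edge_score e \<omega>) * \<Psi> \<omega>"
      using p by (subst integral_uniform_le) auto
    finally show "(\<integral>y. \<Phi>1 (\<omega>, y) \<partial>distr \<Omega> borel (\<eta> e)) =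
        of_bool (edge_score (k, l) \<omega> \<le> edge_score e \<omega>) * \<Psi> \<omega>" .
  qed
  also have "\<dots> = (\<integral>\<omega>. test_survival \<omega> * \<Psi> \<omega> \<partial>\<Omega>)"
  proof -
    define \<Phi>2 where "\<Phi>2 q = of_bool (edge_score (k, l) (fst q) \<le> score (fst q) (snd q)) * \<Psi> (fst q)" for q
    have [measurable]: "(\<lambda>q. score (fst q) (snd q)) \<in> borel_measurable (sig ?A \<Otimes>\<^sub>M edge_space)"
      using score_measurable[OF A(1,3)] by (simp add: split_beta')
    have [measurable]: "edge_score (k, l) \<in> borel_measurable (sig ?A)"
      by (rule edge_score_measurable_sig[OF A])
    note [measurable] = \<Psi>
    have \<Phi>2: "\<Phi>2 \<in> borel_measurable (sig ?A \<Otimes>\<^sub>M edge_space)"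
      unfolding \<Phi>2_def[abs_def] by measurable
    have "(\<integral>\<omega>. of_bool (edge_score (k, l) \<omega> \<le> edge_score e \<omega>) * \<Psi> \<omega> \<partial>\<Omega>) =
        (\<integral>\<omega>. \<Phi>2 (\<omega>, edge_block e \<omega>) \<partial>\<Omega>)"
      by (simp add: \<Phi>2_def edge_score_def)
    also have "\<dots> = (\<integral>\<omega>. (\<integral>b. \<Phi>2 (\<omega>, b) \<partial>distr \<Omega> edge_space (edge_block e)) \<partial>\<Omega>)"
    proof (rule integral_freeze_sig[where A = ?A and B = "edge_sources e" and K = K])
      show "edge_block e \<in> sig (edge_sources e) \<rightarrow>\<^sub>M edge_space"
        using sub by (intro edge_block_measurable_sig) auto
      fix z assume "z \<in> space (sig ?A \<Otimes>\<^sub>M edge_space)"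
      then have "fst z \<in> space \<Omega>"
        by (auto simp: space_pair_measure)
      from bound[OF this] K0 show "\<bar>\<Phi>2 z\<bar> \<le> K"
        by (auto simp: \<Phi>2_def)
    qed (use sub \<Phi>2 in auto)
    also have "\<dots> = (\<integral>\<omega>. test_survival \<omega> * \<Psi> \<omega> \<partial>\<Omega>)"
      unfolding edge_block_law[OF e'] by (simp add: \<Phi>2_def survival_def)
    finally show ?thesis .
  qed
  finally show ?thesis .
qed

lemma C_ge_c: "c \<le> C"
  using w_ge[of 0 0] w_le[of 0 0] by simp

lemma integral_eta_le:
  assumes e: "e \<in> pairs {1..n}"
  shows "(\<integral>\<omega>. of_bool (\<eta> e \<omega> \<le> C * \<rho>) \<partial>\<Omega>) = C * \<rho>"
proof -
  have "(\<integral>\<omega>. of_bool (\<eta> e \<omega> \<le> C * \<rho>) \<partial>\<Omega>) = (\<integral>y. of_bool (y \<le> C * \<rho>) \<partial>distr \<Omega> borel (\<eta> e) :: real)"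
    using eta_measurable[OF e] by (subst integral_distr) auto
  also have "\<dots> = C * \<rho>"
    unfolding eta_law[OF e]
    by (rule integral_uniform_le) (use C_ge_c c_pos rho_pos rho_C in \<open>auto simp: mult.commute\<close>)
  finally show ?thesis .
qed

text \<open>Distinct pairs have distinct and hence independent edge noise, whether or not they share
  a node.\<close>

lemma integral_eta_le_mult:
  assumes e: "e \<in> pairs {1..n}" "e' \<in> pairs {1..n}" "e \<noteq> e'"
  shows "(\<integral>\<omega>. of_bool (\<eta> e \<omega> \<le> C * \<rho>) * of_bool (\<eta> e' \<omega> \<le> C * \<rho>) \<partial>\<Omega>) = (C * \<rho>)\<^sup>2"
proof -
  define \<Phi> where "\<Phi> q = (of_bool (\<eta> e (fst q) \<le> C * \<rho>) * of_bool (snd q \<le> C * \<rho>) :: real)" for q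
  have [measurable]: "\<eta> e \<in> borel_measurable (sig {Eta e})"
    by (rule eta_measurable_sig) simp
  have "(\<integral>\<omega>. of_bool (\<eta> e \<omega> \<le> C * \<rho>) * of_bool (\<eta> e' \<omega> \<le> C * \<rho>) \<partial>\<Omega>) =
      (\<integral>\<omega>. \<Phi> (\<omega>, \<eta> e' \<omega>) \<partial>\<Omega>)"
    by (simp add: \<Phi>_def)
  also have "\<dots> = (\<integral>\<omega>. (\<integral>y. \<Phi> (\<omega>, y) \<partial>distr \<Omega> borel (\<eta> e')) \<partial>\<Omega>)"
  proof (rule integral_freeze_sig[where A = "{Eta e}" and B = "{Eta e'}" and K = 1])
    show "\<Phi> \<in> borel_measurable (sig {Eta e} \<Otimes>\<^sub>M borel)"
      unfolding \<Phi>_def[abs_def] by measurable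
    show "\<eta> e' \<in> borel_measurable (sig {Eta e'})"
      by (rule eta_measurable_sig) simp
  qed (use e in \<open>auto simp: sources_def \<Phi>_def\<close>)
  also have "\<dots> = (\<integral>\<omega>. of_bool (\<eta> e \<omega> \<le> C * \<rho>) * (C * \<rho>) \<partial>\<Omega>)"
    unfolding eta_law[OF e(2)] \<Phi>_def fst_conv snd_conv integral_mult_right_zero
    by (subst integral_uniform_le) (use C_ge_c c_pos rho_pos rho_C in \<open>auto simp: mult.commute\<close>)
  also have "\<dots> = (C * \<rho>)\<^sup>2"
    using integral_eta_le[OF e(1)] by (simp add: power2_eq_square)
  finally show ?thesis .
qed

section \<open>Second moment of the weighted average\<close>

definition far_pairs where
  "far_pairs = {e \<in> pairs (D2 n). {fst e, snd e} \<inter> {k, l} = {}}"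

abbreviation ipw_dev where
  "ipw_dev e \<omega> \<equiv> ipw e \<omega> - test_survival \<omega>"

lemma finite_D2: "finite (D2 n)"
  by (simp add: D2_def)

lemma card_D2: "card (D2 n) = n div 2"
  using even_n by (auto simp: D2_def elim: evenE)

lemma finite_pairs_D2: "finite (pairs (D2 n))"
  by (rule finite_pairs[OF finite_D2])

lemma card_pairs_D2: "card (pairs (D2 n)) = n div 2 choose 2"
  using card_pairs[OF finite_D2] card_D2 by simp

lemma card_meeting_D2:
  "card {e' \<in> pairs (D2 n). {fst e', snd e'} \<inter> {a, b} \<noteq> {}} \<le> n"
proof -
  have "{e' \<in> pairs (D2 n). {fst e', snd e'} \<inter> {a, b} \<noteq> {}} =
      {(i, j) \<in> pairs (D2 n). {i, j} \<inter> {a, b} \<noteq> {}}"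
    by auto
  then show ?thesis
    using card_pairs_meeting[OF finite_D2, of a b] card_D2 even_n by simp
qed

lemma finite_far_pairs: "finite far_pairs"
  using finite_pairs_D2 by (simp add: far_pairs_def)

text \<open>The pairs that share a node with the test pair are excluded because their score is not
  independent of the test score. There are at most \<open>n\<close> of them.\<close>

lemma card_far_pairs:
  "card far_pairs \<le> n div 2 choose 2" "(n div 2 choose 2) \<le> card far_pairs + n"
proof -
  show "card far_pairs \<le> n div 2 choose 2"
    unfolding card_pairs_D2[symmetric] far_pairs_def using finite_pairs_D2 by (intro card_mono) auto
  define R where "R = {e' \<in> pairs (D2 n). {fst e', snd e'} \<inter> {k, l} \<noteq> {}}"
  have "pairs (D2 n) = far_pairs \<union> R"
    by (auto simp: far_pairs_def R_def)
  then have "card (pairs (D2 n)) \<le> card far_pairs + card R"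
    using card_Un_le by simp
  then show "(n div 2 choose 2) \<le> card far_pairs + n"
    using card_meeting_D2[of k l] card_pairs_D2 by (simp add: R_def)
qed

lemma far_pairsD:
  assumes "e \<in> far_pairs"
  shows "e \<in> pairs (D2 n)" "e \<in> pairs {1..n}"
    "edge_sources (k, l) \<inter> insert (Eta e) (edge_sources e) = {}"
proof -
  have e: "e \<in> pairs (D2 n) \<and> {fst e, snd e} \<inter> {k, l} = {}"
    using assms unfolding far_pairs_def by (rule CollectD)
  then show "e \<in> pairs (D2 n)" "e \<in> pairs {1..n}"
    using pairs_D2 by blast+
  show "edge_sources (k, l) \<inter> insert (Eta e) (edge_sources e) = {}"
    using conjunct2[OF e] by (auto simp: edge_sources_def)
qed

lemma ipw_random: "e \<in> pairs {1..n} \<Longrightarrow> ipw e \<in> borel_measurable \<Omega>"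
  using edge_sources_sources[of e "{1..n}"] edge_sources_sources[OF pairs_D2[OF kl_pairs]]
  by (intro measurable_sig_random[OF ipw_measurable_sig[OF sources_D1_subset]]) auto

lemma test_survival_random: "(\<lambda>\<omega>. test_survival \<omega>) \<in> borel_measurable \<Omega>"
  using edge_sources_sources[OF pairs_D2[OF kl_pairs]]
  by (intro measurable_sig_random[OF test_survival_measurable_sig[OF sources_D1_subset]]) auto

lemma ipw_dev_bound:
  assumes "e \<in> pairs {1..n}" "\<omega> \<in> space \<Omega>"
  shows "\<bar>ipw_dev e \<omega>\<bar> \<le> 1 / (c * \<rho>) + 1"
  using ipw_bounds[OF assms] survival_bounds[of \<omega> "edge_score (k, l) \<omega>"] c_pos rho_pos
  by (auto simp: abs_if)

lemma integrable_ipw_dev_mult: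
  assumes "e \<in> pairs {1..n}" "e' \<in> pairs {1..n}"
  shows "integrable \<Omega> (\<lambda>\<omega>. ipw_dev e \<omega> * ipw_dev e' \<omega>)"
proof (rule integrable_const_bound)
  note [measurable] = ipw_random[OF assms(1)] ipw_random[OF assms(2)] test_survival_random
  show "(\<lambda>\<omega>. ipw_dev e \<omega> * ipw_dev e' \<omega>) \<in> borel_measurable \<Omega>"
    by measurable
  show "AE \<omega> in \<Omega>. norm (ipw_dev e \<omega> * ipw_dev e' \<omega>) \<le> (1 / (c * \<rho>) + 1) * (1 / (c * \<rho>) + 1)"
    using ipw_dev_bound[OF assms(1)] ipw_dev_bound[OF assms(2)] c_pos rho_pos
    by (intro AE_I2) (auto simp: abs_mult intro!: mult_mono)
qed

text \<open>The deviation at \<open>e'\<close> involves no source of \<open>e\<close>, so it can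
  serve as the factor \<open>\<Psi>\<close> in \<open>integral_ipw_mult\<close>; the two parts of
  the deviation at \<open>e\<close> then have equal integrals against it.\<close>

lemma ipw_dev_uncorrelated:
  assumes e: "e \<in> far_pairs" and e': "e' \<in> far_pairs"
    and disj: "{fst e', snd e'} \<inter> {fst e, snd e} = {}"
  shows "(\<integral>\<omega>. ipw_dev e \<omega> * ipw_dev e' \<omega> \<partial>\<Omega>) = 0"
proof -
  let ?A = "sources {1..n} - insert (Eta e) (edge_sources e)"
  note kl = pairs_D2[OF kl_pairs]
  have A: "sources (D1 n) \<subseteq> ?A" "edge_sources (k, l) \<subseteq> ?A" "?A \<subseteq> sources {1..n}"
      "insert (Eta e') (edge_sources e') \<subseteq> ?A"
    using sources_D1_disjoint[OF far_pairsD(1)[OF e]] sources_D1_subset edge_sources_sources[OF kl]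
      far_pairsD(3)[OF e] edge_sources_sources[OF far_pairsD(2)[OF e']] disj
    by (auto simp: edge_sources_def)
  have \<Psi>: "ipw_dev e' \<in> borel_measurable (sig ?A)"
    using ipw_measurable_sig[OF A] test_survival_measurable_sig[OF A(1-3)] by measurable
  have [measurable]: "ipw e \<in> borel_measurable \<Omega>" "ipw e' \<in> borel_measurable \<Omega>"
      "(\<lambda>\<omega>. test_survival \<omega>) \<in> borel_measurable \<Omega>"
    using e e' by (auto intro!: ipw_random test_survival_random far_pairsD(2))
  have cr: "0 < c * \<rho>"
    using c_pos rho_pos by simp
  note dev = ipw_dev_bound[OF far_pairsD(2)[OF e']]
  have int1: "integrable \<Omega> (\<lambda>\<omega>. ipw e \<omega> * ipw_dev e' \<omega>)"
  proof (rule integrable_const_bound)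
    show "AE \<omega> in \<Omega>. norm (ipw e \<omega> * ipw_dev e' \<omega>) \<le> 1 / (c * \<rho>) * (1 / (c * \<rho>) + 1)"
    proof (rule AE_I2)
      fix \<omega> assume \<omega>: "\<omega> \<in> space \<Omega>"
      have "\<bar>ipw e \<omega>\<bar> \<le> 1 / (c * \<rho>)"
        using ipw_bounds(1,3)[OF far_pairsD(2)[OF e] \<omega>] by simp
      then show "norm (ipw e \<omega> * ipw_dev e' \<omega>) \<le> 1 / (c * \<rho>) * (1 / (c * \<rho>) + 1)"
        unfolding real_norm_def abs_mult using cr by (intro mult_mono dev[OF \<omega>]) simp_all
    qed
  qed simp
  have int2: "integrable \<Omega> (\<lambda>\<omega>. test_survival \<omega> * ipw_dev e' \<omega>)"
  proof (rule integrable_const_bound)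
    show "AE \<omega> in \<Omega>. norm (test_survival \<omega> * ipw_dev e' \<omega>) \<le> 1 * (1 / (c * \<rho>) + 1)"
    proof (rule AE_I2)
      fix \<omega> assume \<omega>: "\<omega> \<in> space \<Omega>"
      have "\<bar>test_survival \<omega>\<bar> \<le> 1"
        using survival_bounds[of \<omega> "edge_score (k, l) \<omega>"] by simp
      then show "norm (test_survival \<omega> * ipw_dev e' \<omega>) \<le> 1 * (1 / (c * \<rho>) + 1)"
        unfolding real_norm_def abs_mult by (intro mult_mono dev[OF \<omega>]) simp_all
    qed
  qed simp
  have "(\<integral>\<omega>. ipw_dev e \<omega> * ipw_dev e' \<omega> \<partial>\<Omega>) =
      (\<integral>\<omega>. ipw e \<omega> * ipw_dev e' \<omega> \<partial>\<Omega>) - (\<integral>\<omega>. test_survival \<omega> * ipw_dev e' \<omega> \<partial>\<Omega>)"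
    by (subst Bochner_Integration.integral_diff[OF int1 int2, symmetric]) (simp add: left_diff_distrib)
  also have "\<dots> = 0"
    using integral_ipw_mult[OF far_pairsD(1,3)[OF e] \<Psi> ipw_dev_bound[OF far_pairsD(2)[OF e']]] by simp
  finally show ?thesis .
qed

text \<open>The nonnegative cross terms are dropped and the constant-threshold majorants inserted. A
  single indicator contributes one factor \<open>\<rho>\<close> against two in the denominator,
  hence 1/rho on the diagonal; off the diagonal two independent indicators cancel the
  density.\<close>

lemma integral_ipw_dev_mult_le:
  assumes e: "e \<in> pairs {1..n}" and e': "e' \<in> pairs {1..n}"
  shows "(\<integral>\<omega>. ipw_dev e \<omega> * ipw_dev e' \<omega> \<partial>\<Omega>) \<le>
    (if e = e' then C / (c\<^sup>2 * \<rho>) + 1 else C\<^sup>2 / c\<^sup>2 + 1)"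
proof -
  have cr: "0 < c * \<rho>"
    using c_pos rho_pos by simp
  define q where "q \<omega> = (of_bool (\<eta> e \<omega> \<le> C * \<rho>) * of_bool (\<eta> e' \<omega> \<le> C * \<rho>) :: real)" for \<omega>
  note [measurable] = eta_measurable[OF e] eta_measurable[OF e']
  have q_int: "integrable \<Omega> q"
    unfolding q_def[abs_def] by (intro integrable_const_bound[where B = 1]) auto
  have "(\<integral>\<omega>. ipw_dev e \<omega> * ipw_dev e' \<omega> \<partial>\<Omega>) \<le> (\<integral>\<omega>. q \<omega> / (c * \<rho>)\<^sup>2 + 1 \<partial>\<Omega>)"
  proof (rule integral_mono)
    show "integrable \<Omega> (\<lambda>\<omega>. ipw_dev e \<omega> * ipw_dev e' \<omega>)"
      by (rule integrable_ipw_dev_mult[OF assms])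
    show "integrable \<Omega> (\<lambda>\<omega>. q \<omega> / (c * \<rho>)\<^sup>2 + 1)"
      using q_int by simp
    fix \<omega> assume \<omega>: "\<omega> \<in> space \<Omega>"
    note b = ipw_bounds[OF e \<omega>] ipw_bounds[OF e' \<omega>] survival_bounds[of \<omega> "edge_score (k, l) \<omega>"]
    have "ipw_dev e \<omega> * ipw_dev e' \<omega> =
        ipw e \<omega> * ipw e' \<omega> - test_survival \<omega> * (ipw e \<omega> + ipw e' \<omega>) + test_survival \<omega> * test_survival \<omega>"
      by (simp add: algebra_simps)
    also have "\<dots> \<le> ipw e \<omega> * ipw e' \<omega> + 1"
    proof -
      have "0 \<le> test_survival \<omega> * (ipw e \<omega> + ipw e' \<omega>)"
        using b by simp
      moreover have "test_survival \<omega> * test_survival \<omega> \<le> 1"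
        using b by (simp add: mult_le_one)
      ultimately show ?thesis
        by linarith
    qed
    also have "ipw e \<omega> * ipw e' \<omega> \<le> (of_bool (\<eta> e \<omega> \<le> C * \<rho>) / (c * \<rho>)) * (of_bool (\<eta> e' \<omega> \<le> C * \<rho>) / (c * \<rho>))"
      using b cr by (intro mult_mono) auto
    also have "\<dots> = q \<omega> / (c * \<rho>)\<^sup>2"
      by (simp add: q_def power2_eq_square)
    finally show "ipw_dev e \<omega> * ipw_dev e' \<omega> \<le> q \<omega> / (c * \<rho>)\<^sup>2 + 1"
      by simp
  qed
  also have "\<dots> = (\<integral>\<omega>. q \<omega> \<partial>\<Omega>) / (c * \<rho>)\<^sup>2 + 1"
    using q_int by (subst Bochner_Integration.integral_add) (auto simp: prob_space)
  also have "(\<integral>\<omega>. q \<omega> \<partial>\<Omega>) = (if e = e' then C * \<rho> else (C * \<rho>)\<^sup>2)"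
    using integral_eta_le[OF e] integral_eta_le_mult[OF assms]
    by (cases "e = e'") (simp_all add: q_def flip: of_bool_conj)
  also have "\<dots> / (c * \<rho>)\<^sup>2 + 1 = (if e = e' then C / (c\<^sup>2 * \<rho>) + 1 else C\<^sup>2 / c\<^sup>2 + 1)"
    using c_pos rho_pos by (simp add: power2_eq_square)
  finally show ?thesis .
qed

text \<open>In each row of the covariance matrix, only the diagonal and the at most \<open>n\<close>
  pairs that share a node with \<open>e\<close> contribute.\<close>

lemma second_moment:
  "(\<integral>\<omega>. (\<Sum>e\<in>far_pairs. ipw_dev e \<omega>)\<^sup>2 \<partial>\<Omega>)
    \<le> real (n div 2 choose 2) * (C / (c\<^sup>2 * \<rho>) + 1 + real n * (C\<^sup>2 / c\<^sup>2 + 1))"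
proof -
  let ?a = "C / (c\<^sup>2 * \<rho>) + 1" and ?b = "C\<^sup>2 / c\<^sup>2 + 1"
  let ?I = "\<lambda>e e'. \<integral>\<omega>. ipw_dev e \<omega> * ipw_dev e' \<omega> \<partial>\<Omega>"
  have ab: "0 \<le> ?a" "0 \<le> ?b"
    using C_ge_c c_pos rho_pos by auto
  have row: "(\<Sum>e'\<in>far_pairs. ?I e e') \<le> ?a + real n * ?b" if e: "e \<in> far_pairs" for e
  proof -
    let ?J = "{e' \<in> far_pairs. {fst e', snd e'} \<inter> {fst e, snd e} \<noteq> {}}"
    have J: "finite ?J" "e \<in> ?J"
      using finite_far_pairs e by auto
    have "(\<Sum>e'\<in>far_pairs. ?I e e') = (\<Sum>e'\<in>?J. ?I e e')"
      using finite_far_pairs ipw_dev_uncorrelated[OF e] by (intro sum.mono_neutral_right) auto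
    also have "\<dots> = ?I e e + (\<Sum>e'\<in>?J - {e}. ?I e e')"
      using J by (rule sum.remove)
    also have "\<dots> \<le> ?a + (\<Sum>e'\<in>?J - {e}. ?b)"
    proof (intro add_mono sum_mono)
      show "?I e e \<le> ?a"
        using integral_ipw_dev_mult_le[OF far_pairsD(2)[OF e] far_pairsD(2)[OF e]] by simp
      fix e' assume "e' \<in> ?J - {e}"
      then have e': "e' \<in> far_pairs" "e \<noteq> e'"
        by blast+
      show "?I e e' \<le> ?b"
        using integral_ipw_dev_mult_le[OF far_pairsD(2)[OF e] far_pairsD(2)[OF e'(1)]] e'(2) by simp
    qed
    also have "(\<Sum>e'\<in>?J - {e}. ?b) \<le> real n * ?b"
    proof -
      have "card (?J - {e}) \<le> card {e' \<in> pairs (D2 n). {fst e', snd e'} \<inter> {fst e, snd e} \<noteq> {}}"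
        using finite_pairs_D2 by (intro card_mono) (auto simp: far_pairs_def)
      also have "\<dots> \<le> n"
        by (rule card_meeting_D2)
      finally show ?thesis
        unfolding sum_constant using ab(2) by (intro mult_right_mono) simp_all
    qed
    finally show ?thesis
      by simp
  qed
  have "(\<integral>\<omega>. (\<Sum>e\<in>far_pairs. ipw_dev e \<omega>)\<^sup>2 \<partial>\<Omega>) =
      (\<integral>\<omega>. (\<Sum>e\<in>far_pairs. \<Sum>e'\<in>far_pairs. ipw_dev e \<omega> * ipw_dev e' \<omega>) \<partial>\<Omega>)"
    by (simp add: power2_eq_square sum_product)
  also have "\<dots> = (\<Sum>e\<in>far_pairs. \<integral>\<omega>. (\<Sum>e'\<in>far_pairs. ipw_dev e \<omega> * ipw_dev e' \<omega>) \<partial>\<Omega>)"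
    by (intro Bochner_Integration.integral_sum Bochner_Integration.integrable_sum
        integrable_ipw_dev_mult far_pairsD(2))
  also have "\<dots> = (\<Sum>e\<in>far_pairs. \<Sum>e'\<in>far_pairs. ?I e e')"
    by (intro sum.cong refl Bochner_Integration.integral_sum integrable_ipw_dev_mult far_pairsD(2))
  also have "\<dots> \<le> (\<Sum>e\<in>far_pairs. ?a + real n * ?b)"
    by (intro sum_mono row)
  also have "\<dots> \<le> real (n div 2 choose 2) * (?a + real n * ?b)"
    unfolding sum_constant using card_far_pairs(1) add_nonneg_nonneg[OF ab(1) mult_nonneg_nonneg[OF _ ab(2)]]
    by (intro mult_right_mono) simp_all
  finally show ?thesis .
qed

section \<open>Lower bound for the conformal p-value\<close>

abbreviation N2 :: real where
  "N2 \<equiv> real (n div 2 choose 2)"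

definition sq_error :: "'a \<Rightarrow> real" where
  "sq_error \<omega> = (L2_set (\<lambda>(i, j). p_hat i j \<omega> - \<rho> * w (\<xi> i \<omega>) (\<xi> j \<omega>)) ({1..n} \<times> {1..n}))\<^sup>2"

lemma sq_error_eq:
  "sq_error \<omega> = (\<Sum>e\<in>{1..n} \<times> {1..n}. (p_hat (fst e) (snd e) \<omega> - edge_prob e \<omega>)\<^sup>2)"
  by (simp add: sq_error_def L2_set_def sum_nonneg edge_prob_def split_beta')

lemma M_indicator:
  assumes "e \<in> pairs {1..n}" "\<omega> \<in> space \<Omega>"
  shows "M (fst e) (snd e) \<omega> = of_bool (\<eta> e \<omega> \<le> edge_prob e \<omega>)"
  using M_eq[of "fst e" "snd e" \<omega>] assms edge_prob_bounds(4)[OF assms]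
  by (simp add: edge_prob_def)

definition selected where
  "selected e \<omega> \<longleftrightarrow> e = (k, l) \<or> M (fst e) (snd e) \<omega> = 1"

text \<open>At the candidate value \<open>Y k l \<omega>\<close> the substituted scores are the
  actual ones. Moving the random index set into the indicator \<open>selected\<close> leaves a sum
  over fixed pairs, suited to termwise comparison and to measurability.\<close>

lemma Pi_weighted_eq:
  assumes \<omega>: "\<omega> \<in> space \<Omega>"
  shows "Pi_weighted n X Y M h s p_hat k l \<omega> (Y k l \<omega>) = 1 / (N2 * (1 - rho_hat n M \<omega>)) *
    (\<Sum>e\<in>pairs (D2 n). of_bool (selected e \<omega>) * ((1 - p_hat (fst e) (snd e) \<omega>) / p_hat (fst e) (snd e) \<omega> *
       of_bool (edge_score (k, l) \<omega> \<le> edge_score e \<omega>)))"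
proof -
  let ?f = "\<lambda>e. (1 - p_hat (fst e) (snd e) \<omega>) / p_hat (fst e) (snd e) \<omega> *
       of_bool (edge_score (k, l) \<omega> \<le> edge_score e \<omega>)"
  have score: "score_at X Y h s k l \<omega> (Y k l \<omega>) (fst e) (snd e) = edge_score e \<omega>"
    if "e \<in> pairs (D2 n)" for e
    using edge_score_eq[of "fst e" "snd e" \<omega>] pairs_D2[OF that] \<omega> by (auto simp: score_at_def)
  have sel: "insert (k, l) (calibration_set n M \<omega>) = {e \<in> pairs (D2 n). selected e \<omega>}"
    using kl_pairs by (auto simp: calibration_set_def selected_def)
  have "(\<Sum>(i, j)\<in>insert (k, l) (calibration_set n M \<omega>).
       (1 - p_hat i j \<omega>) / p_hat i j \<omega> *
       of_bool (score_at X Y h s k l \<omega> (Y k l \<omega>) i j \<ge> score_at X Y h s k l \<omega> (Y k l \<omega>) k l)) =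
      (\<Sum>e\<in>{e \<in> pairs (D2 n). selected e \<omega>}. ?f e)"
    unfolding sel using score score[OF kl_pairs] by (intro sum.cong) (auto simp: split_beta')
  also have "\<dots> = (\<Sum>e\<in>pairs (D2 n). if selected e \<omega> then ?f e else 0)"
    using finite_pairs_D2 by (rule sum.inter_filter)
  also have "\<dots> = (\<Sum>e\<in>pairs (D2 n). of_bool (selected e \<omega>) * ?f e)"
    by (intro sum.cong) auto
  finally show ?thesis
    by (simp add: Pi_weighted_def)
qed

text \<open>The estimate \<open>p_hat\<close> may exceed \<open>1\<close>, but a weight is never below \<open>-1\<close>; this accounts for the
  last two subtracted terms.\<close>

lemma selected_weight_ge:
  assumes e: "e \<in> pairs (D2 n)" and \<omega>: "\<omega> \<in> space \<Omega>"
    and p_hat: "c \<le> p_hat (fst e) (snd e) \<omega> / \<rho>"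
  shows "of_bool (e \<in> far_pairs) * ipw e \<omega>
      - M (fst e) (snd e) \<omega> * \<bar>p_hat (fst e) (snd e) \<omega> - edge_prob e \<omega>\<bar> / (c\<^sup>2 * \<rho>\<^sup>2)
      - M (fst e) (snd e) \<omega> - of_bool (e = (k, l))
    \<le> of_bool (selected e \<omega>) * ((1 - p_hat (fst e) (snd e) \<omega>) / p_hat (fst e) (snd e) \<omega> *
       of_bool (edge_score (k, l) \<omega> \<le> edge_score e \<omega>))"
    (is "?l \<le> ?r")
proof -
  define q p S where "q = p_hat (fst e) (snd e) \<omega>" and "p = edge_prob e \<omega>"
    and "S = (of_bool (edge_score (k, l) \<omega> \<le> edge_score e \<omega>) :: real)"
  have S: "0 \<le> S" "S \<le> 1"
    by (simp_all add: S_def)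
  have cr: "0 < c * \<rho>"
    using c_pos rho_pos by simp
  have q: "c * \<rho> \<le> q"
    using p_hat rho_pos by (simp add: q_def field_simps)
  have p: "c * \<rho> \<le> p"
    using edge_prob_bounds[OF pairs_D2[OF e] \<omega>] by (simp add: p_def)
  note m = M_indicator[OF pairs_D2[OF e] \<omega>]
  have ipw: "ipw e \<omega> = M (fst e) (snd e) \<omega> / p * S"
    by (simp add: ipw_def m p_def S_def)
  \<comment> \<open>The right side equals \<open>S / q - S\<close>, and \<open>S\<close> is at most
    1.\<close>
  have ge: "S / q - 1 \<le> (1 - q) / q * S"
    using q cr S by (simp add: field_simps)
  have S_q: "0 \<le> S / q"
    using q cr S by simp
  have "S / p - S / q \<le> \<bar>q - p\<bar> / (c\<^sup>2 * \<rho>\<^sup>2)"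
  proof -
    have "S / p - S / q = S * (q - p) / (p * q)"
      using p q cr by (simp add: field_simps)
    also have "\<dots> \<le> \<bar>q - p\<bar> / ((c * \<rho>) * (c * \<rho>))"
    proof (rule frac_le)
      show "S * (q - p) \<le> \<bar>q - p\<bar>"
        using S mult_left_le_one_le[of "\<bar>q - p\<bar>" S] mult_left_mono[of "q - p" "\<bar>q - p\<bar>" S] by linarith
      show "c * \<rho> * (c * \<rho>) \<le> p * q"
        using p q cr by (intro mult_mono) auto
    qed (use cr in auto)
    finally show ?thesis
      by (simp add: power2_eq_square algebra_simps)
  qed
  moreover define D where "D = \<bar>q - p\<bar> / (c\<^sup>2 * \<rho>\<^sup>2)"
  ultimately have D: "S / p - S / q \<le> D" "0 \<le> D"
    by simp_all
  define Z where "Z = (1 - q) / q * S"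
  have far: "e \<noteq> (k, l)" if "e \<in> far_pairs"
    using that by (auto simp: far_pairs_def)
  \<comment> \<open>Here \<open>b\<close> stands for the value of \<open>M\<close>. For
    \<open>b = 1\<close> the claim follows from \<open>ge\<close> with \<open>D\<close> or
    \<open>S_q\<close>; for \<open>b = 0\<close> only the test pair is selected, and it is not a far
    pair.\<close>
  have "of_bool (e \<in> far_pairs) * (b / p * S) - b * D - b - of_bool (e = (k, l)) \<le> of_bool (e = (k, l) \<or> b = 1) * Z"
    if "b = 0 \<or> b = 1" for b :: real
    using that ge[folded Z_def] S_q D far by (cases "e \<in> far_pairs") (auto simp: of_bool_def)
  from this[of "M (fst e) (snd e) \<omega>"] show ?thesis
    unfolding ipw q_def[symmetric] p_def[symmetric] S_def[symmetric] selected_def D_def Z_def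
    by (simp add: m)
qed

lemma sum_M_eq:
  assumes "0 < N2"
  shows "(\<Sum>e\<in>pairs (D2 n). M (fst e) (snd e) \<omega>) = N2 * rho_hat n M \<omega>"
  using assms by (simp add: rho_hat_def split_beta')

text \<open>Since \<open>M\<close> is 0 or 1, its square in Young's inequality is \<open>M\<close>
  itself, so the first term counts observed pairs only. This is where sparsity is gained; the
  squared differences are bounded by the full Frobenius norm.\<close>

lemma sum_weighted_error_le:
  assumes \<omega>: "\<omega> \<in> space \<Omega>" and "0 < t" and "0 < N2"
  shows "(\<Sum>e\<in>pairs (D2 n). M (fst e) (snd e) \<omega> * \<bar>p_hat (fst e) (snd e) \<omega> - edge_prob e \<omega>\<bar>)
    \<le> (t * (N2 * rho_hat n M \<omega>) + sq_error \<omega> / t) / 2"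
proof -
  let ?d = "\<lambda>e. p_hat (fst e) (snd e) \<omega> - edge_prob e \<omega>" and ?m = "\<lambda>e. M (fst e) (snd e) \<omega>"
  have "(\<Sum>e\<in>pairs (D2 n). ?m e * \<bar>?d e\<bar>) \<le> (\<Sum>e\<in>pairs (D2 n). (t * ?m e + (?d e)\<^sup>2 / t) / 2)"
  proof (rule sum_mono)
    fix e assume e: "e \<in> pairs (D2 n)"
    have "(?m e)\<^sup>2 = ?m e"
      by (simp add: M_indicator[OF pairs_D2[OF e] \<omega>])
    then show "?m e * \<bar>?d e\<bar> \<le> (t * ?m e + (?d e)\<^sup>2 / t) / 2"
      using young_le[OF \<open>0 < t\<close>, of "?m e" "\<bar>?d e\<bar>"] by simp
  qed
  also have "\<dots> = (t * (\<Sum>e\<in>pairs (D2 n). ?m e) + (\<Sum>e\<in>pairs (D2 n). (?d e)\<^sup>2) / t) / 2"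
    by (simp add: sum.distrib sum_distrib_left sum_divide_distrib add_divide_distrib)
  also have "\<dots> \<le> (t * (N2 * rho_hat n M \<omega>) + sq_error \<omega> / t) / 2"
  proof -
    have "pairs (D2 n) \<subseteq> {1..n} \<times> {1..n}"
      using pairs_D2 by (auto simp: pairs_def)
    then have "(\<Sum>e\<in>pairs (D2 n). (?d e)\<^sup>2) \<le> sq_error \<omega>"
      unfolding sq_error_eq by (intro sum_mono2) auto
    then show ?thesis
      unfolding sum_M_eq[OF \<open>0 < N2\<close>] using \<open>0 < t\<close> by (simp add: divide_right_mono)
  qed
  finally show ?thesis .
qed

text \<open>The threshold for \<open>sq_error\<close> is chosen such that Young's inequality with weight
  \<open>\<rho> \<delta> c\<^sup>2 / K\<close> bounds the effect of estimating the propensities by \<open>\<delta>\<close>.\<close>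

lemma Pi_weighted_gt:
  assumes \<omega>: "\<omega> \<in> space \<Omega>" and p_hat: "\<forall>i\<in>{1..n}. \<forall>j\<in>{1..n}. c \<le> p_hat i j \<omega> / \<rho>"
    and N2: "0 < N2" and \<alpha>: "0 \<le> \<alpha>" and \<delta>: "0 < \<delta>" and K: "0 < K" "K * \<rho> < 1"
    and small: "K * \<rho> + (real n + 1) / N2 \<le> \<delta>"
    and rho_hat: "rho_hat n M \<omega> < K * \<rho>"
    and sq_error: "sq_error \<omega> < \<delta>\<^sup>2 * c ^ 4 / K * N2 * \<rho> ^ 3"
    and dev: "\<bar>\<Sum>e\<in>far_pairs. ipw_dev e \<omega>\<bar> < \<delta> * N2"
    and surv: "\<alpha> + 3 * \<delta> < test_survival \<omega>"
  shows "\<alpha> < Pi_weighted n X Y M h s p_hat k l \<omega> (Y k l \<omega>)"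
proof -
  let ?P = "pairs (D2 n)" and ?m = "\<lambda>e. M (fst e) (snd e) \<omega>" and ?r = "rho_hat n M \<omega>"
  let ?d = "\<lambda>e. \<bar>p_hat (fst e) (snd e) \<omega> - edge_prob e \<omega>\<bar>"
  define T where "T = (\<Sum>e\<in>?P. of_bool (selected e \<omega>) * ((1 - p_hat (fst e) (snd e) \<omega>) / p_hat (fst e) (snd e) \<omega> *
       of_bool (edge_score (k, l) \<omega> \<le> edge_score e \<omega>)))"
  define \<tau> where "\<tau> = \<delta> * c\<^sup>2 / K"
  have \<tau>: "0 < \<tau>"
    using \<delta> c_pos K by (simp add: \<tau>_def)
  have r0: "0 \<le> ?r"
    using M_indicator[OF pairs_D2 \<omega>] by (auto simp: rho_hat_def split_beta' intro!: divide_nonneg_nonneg sum_nonneg)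
  \<comment> \<open>With this \<open>\<tau>\<close>, after the bounds on \<open>rho_hat\<close> and
    \<open>sq_error\<close> are inserted, both Young terms equal the target
    \<open>\<delta> * N2 * (c\<^sup>2 * \<rho>\<^sup>2)\<close>, and their mean is that
    value.\<close>
  have err: "(\<Sum>e\<in>?P. ?m e * ?d e) / (c\<^sup>2 * \<rho>\<^sup>2) \<le> \<delta> * N2"
  proof -
    have "(\<Sum>e\<in>?P. ?m e * ?d e) \<le> (\<rho> * \<tau> * (N2 * ?r) + sq_error \<omega> / (\<rho> * \<tau>)) / 2"
      using \<tau> rho_pos by (intro sum_weighted_error_le \<omega> N2) simp
    also have "\<dots> \<le> (\<rho> * \<tau> * (N2 * (K * \<rho>)) + (\<delta>\<^sup>2 * c ^ 4 / K * N2 * \<rho> ^ 3) / (\<rho> * \<tau>)) / 2"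
      using \<tau> rho_pos N2 rho_hat sq_error
      by (intro divide_right_mono add_mono mult_left_mono) auto
    also have "\<dots> = \<delta> * N2 * (c\<^sup>2 * \<rho>\<^sup>2)"
      using \<delta> c_pos K rho_pos by (simp add: \<tau>_def field_simps power2_eq_square power3_eq_cube power4_eq_xxxx)
    finally show ?thesis
      using c_pos rho_pos by (simp add: divide_le_eq)
  qed
  have far: "N2 * test_survival \<omega> - real n - \<delta> * N2 \<le> (\<Sum>e\<in>far_pairs. ipw e \<omega>)"
  proof -
    have "(N2 - real n) * test_survival \<omega> \<le> real (card far_pairs) * test_survival \<omega>"
      using card_far_pairs(2) survival_bounds by (intro mult_right_mono) auto
    moreover have "real n * test_survival \<omega> \<le> real n"
      using survival_bounds by (simp add: mult_left_le)
    moreover have "(\<Sum>e\<in>far_pairs. ipw e \<omega>) = (\<Sum>e\<in>far_pairs. ipw_dev e \<omega>) + real (card far_pairs) * test_survival \<omega>"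
      by (simp add: sum_subtractf)
    ultimately show ?thesis
      using dev by (simp add: algebra_simps)
  qed
  have "(\<Sum>e\<in>far_pairs. ipw e \<omega>) - (\<Sum>e\<in>?P. ?m e * ?d e) / (c\<^sup>2 * \<rho>\<^sup>2) - N2 * ?r - 1 =
      (\<Sum>e\<in>?P. of_bool (e \<in> far_pairs) * ipw e \<omega> - ?m e * ?d e / (c\<^sup>2 * \<rho>\<^sup>2) - ?m e - of_bool (e = (k, l)))"
  proof -
    have "(\<Sum>e\<in>?P. of_bool (e \<in> far_pairs) * ipw e \<omega>) = (\<Sum>e\<in>far_pairs. ipw e \<omega>)"
      using finite_pairs_D2 by (intro sum.mono_neutral_cong_right) (auto simp: far_pairs_def)
    moreover have "(\<Sum>e\<in>?P. of_bool (e = (k, l)) :: real) = 1"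
      using finite_pairs_D2 kl_pairs by (simp add: of_bool_def)
    ultimately show ?thesis
      by (simp add: sum_subtractf sum_M_eq[OF N2] sum_divide_distrib)
  qed
  also have "\<dots> \<le> T"
    unfolding T_def
  proof (rule sum_mono)
    fix e assume e: "e \<in> ?P"
    then have "fst e \<in> {1..n}" "snd e \<in> {1..n}"
      using pairs_D2[OF e] by (auto simp: pairs_def)
    with p_hat have "c \<le> p_hat (fst e) (snd e) \<omega> / \<rho>"
      by blast
    from selected_weight_ge[OF e \<omega> this]
    show "of_bool (e \<in> far_pairs) * ipw e \<omega> - ?m e * ?d e / (c\<^sup>2 * \<rho>\<^sup>2) - ?m e - of_bool (e = (k, l))
      \<le> of_bool (selected e \<omega>) * ((1 - p_hat (fst e) (snd e) \<omega>) / p_hat (fst e) (snd e) \<omega> *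
         of_bool (edge_score (k, l) \<omega> \<le> edge_score e \<omega>))" .
  qed
  finally have T1: "N2 * test_survival \<omega> - real n - \<delta> * N2 - \<delta> * N2 - N2 * ?r - 1 \<le> T"
    using err far by linarith
  \<comment> \<open>Of the slack \<open>3 * \<delta>\<close> in \<open>surv\<close>, one part pays
    for the estimated propensities and one for the deviation. By \<open>small\<close>, the third
    pays for the remaining losses \<open>N2 * ?r\<close>, \<open>n\<close> and 1.\<close>
  have "N2 * (K * \<rho> + (real n + 1) / N2) \<le> N2 * \<delta>"
    using small N2 by (intro mult_left_mono) auto
  moreover have "N2 * ((real n + 1) / N2) = real n + 1"
    unfolding times_divide_eq_right by (rule nonzero_mult_div_cancel_left) (use N2 in linarith)
  ultimately have "N2 * (K * \<rho>) + real n + 1 \<le> N2 * \<delta>"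
    by (simp only: distrib_left)
  moreover have "N2 * ?r \<le> N2 * (K * \<rho>)"
    using rho_hat N2 by simp
  moreover have "N2 * (\<alpha> + 3 * \<delta>) < N2 * test_survival \<omega>"
    using surv N2 by simp
  ultimately have T: "N2 * \<alpha> < T"
    using T1 by (simp add: algebra_simps)
  have "\<alpha> < T / N2"
    using T N2 by (simp add: field_simps)
  \<comment> \<open>The factor \<open>1 - ?r\<close> lies in (0, 1] because
    \<open>?r < K * \<rho> < 1\<close>, and \<open>T\<close> is nonnegative, so restoring it only
    enlarges the quotient.\<close>
  also have "\<dots> \<le> T / (N2 * (1 - ?r))"
  proof (rule divide_left_mono)
    show "N2 * (1 - ?r) \<le> N2"
      using N2 r0 by simp
    show "0 \<le> T"
      using T N2 \<alpha> by (meson less_imp_le mult_nonneg_nonneg order_le_less_trans)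
    show "0 < N2 * (N2 * (1 - ?r))"
      using N2 rho_hat K by simp
  qed
  finally show ?thesis
    unfolding Pi_weighted_eq[OF \<omega>] T_def[symmetric] by simp
qed

section \<open>Coverage for finite \<open>n\<close>\<close>

lemma M_random: "e \<in> pairs {1..n} \<Longrightarrow> M (fst e) (snd e) \<in> borel_measurable \<Omega>"
  using edge_sources_sources[of e "{1..n}"]
  by (intro measurable_sig_random[OF M_measurable_sig[of "fst e" "snd e" "sources {1..n}"]]) auto

lemma p_hat_random: "i \<in> {1..n} \<Longrightarrow> j \<in> {1..n} \<Longrightarrow> p_hat i j \<in> borel_measurable \<Omega>"
  by (rule measurable_sig_random[OF observed_data_measurable_sig[OF p_hat_estimator order_refl order_refl order_refl]
        order_refl])

lemma rho_hat_random: "rho_hat n M \<in> borel_measurable \<Omega>"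
proof -
  have "(\<lambda>\<omega>. \<Sum>e\<in>pairs (D2 n). M (fst e) (snd e) \<omega>) \<in> borel_measurable \<Omega>"
    by (intro borel_measurable_sum M_random pairs_D2)
  then show ?thesis
    unfolding rho_hat_def[abs_def] split_beta' by (rule borel_measurable_divide) simp
qed

lemma sq_error_random: "sq_error \<in> borel_measurable \<Omega>"
proof -
  have "(\<lambda>\<omega>. (p_hat (fst e) (snd e) \<omega> - edge_prob e \<omega>)\<^sup>2) \<in> borel_measurable \<Omega>"
    if "e \<in> {1..n} \<times> {1..n}" for e
  proof -
    have "fst e \<in> {1..n}" "snd e \<in> {1..n}"
      using that by auto
    then have [measurable]: "p_hat (fst e) (snd e) \<in> borel_measurable \<Omega>" "edge_prob e \<in> borel_measurable \<Omega>"
      by (auto intro!: p_hat_random measurable_sig_random[OF edge_prob_measurable_nodes, of _ "sources {1..n}"]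
          simp: sources_def)
    show ?thesis
      by measurable
  qed
  then show ?thesis
    unfolding sq_error_eq[abs_def] by (rule borel_measurable_sum)
qed

lemma Pi_weighted_random:
  "{\<omega> \<in> space \<Omega>. \<alpha> < Pi_weighted n X Y M h s p_hat k l \<omega> (Y k l \<omega>)} \<in> events"
proof -
  have *: "(\<lambda>\<omega>. of_bool (selected e \<omega>) * ((1 - p_hat (fst e) (snd e) \<omega>) / p_hat (fst e) (snd e) \<omega> *
       of_bool (edge_score (k, l) \<omega> \<le> edge_score e \<omega>))) \<in> borel_measurable \<Omega>"
    if e: "e \<in> pairs (D2 n)" for e
  proof -
    note e' = pairs_D2[OF e]
    have "fst e \<in> {1..n}" "snd e \<in> {1..n}"
      using e' by (auto simp: pairs_def)
    then have [measurable]: "p_hat (fst e) (snd e) \<in> borel_measurable \<Omega>"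
      by (rule p_hat_random)
    have edge: "edge_score e' \<in> borel_measurable \<Omega>" if "e' \<in> pairs {1..n}" for e'
      using edge_sources_subset[OF that] sources_D1_subset
      by (intro measurable_sig_random[OF edge_score_measurable_sig[of "sources {1..n}"]]) auto
    note [measurable] = edge[OF e'] edge[OF pairs_D2[OF kl_pairs]] M_random[OF e']
    show ?thesis
      unfolding selected_def by measurable
  qed
  have [measurable]: "(\<lambda>\<omega>. \<Sum>e\<in>pairs (D2 n). of_bool (selected e \<omega>) *
      ((1 - p_hat (fst e) (snd e) \<omega>) / p_hat (fst e) (snd e) \<omega> *
       of_bool (edge_score (k, l) \<omega> \<le> edge_score e \<omega>))) \<in> borel_measurable \<Omega>"
    by (rule borel_measurable_sum[OF *])
  note [measurable] = rho_hat_random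
  have "{\<omega> \<in> space \<Omega>. \<alpha> < 1 / (N2 * (1 - rho_hat n M \<omega>)) *
      (\<Sum>e\<in>pairs (D2 n). of_bool (selected e \<omega>) *
      ((1 - p_hat (fst e) (snd e) \<omega>) / p_hat (fst e) (snd e) \<omega> *
       of_bool (edge_score (k, l) \<omega> \<le> edge_score e \<omega>)))} \<in> events"
    by measurable
  also have "?this \<longleftrightarrow> ?thesis"
    by (intro arg_cong[where f = "\<lambda>A. A \<in> events"] Collect_cong conj_cong refl) (simp add: Pi_weighted_eq)
  finally show ?thesis .
qed

lemma expectation_M_le:
  assumes e: "e \<in> pairs {1..n}"
  shows "integrable \<Omega> (M (fst e) (snd e))" "(\<integral>\<omega>. M (fst e) (snd e) \<omega> \<partial>\<Omega>) \<le> C * \<rho>"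
proof -
  note [measurable] = M_random[OF e] eta_measurable[OF e]
  show int: "integrable \<Omega> (M (fst e) (snd e))"
    by (rule integrable_const_bound[where B = 1]) (auto simp: M_indicator[OF e])
  have "(\<integral>\<omega>. M (fst e) (snd e) \<omega> \<partial>\<Omega>) \<le> (\<integral>\<omega>. of_bool (\<eta> e \<omega> \<le> C * \<rho>) \<partial>\<Omega>)"
  proof (rule integral_mono[OF int])
    show "integrable \<Omega> (\<lambda>\<omega>. of_bool (\<eta> e \<omega> \<le> C * \<rho>) :: real)"
      by (rule integrable_const_bound[where B = 1]) auto
    show "M (fst e) (snd e) \<omega> \<le> of_bool (\<eta> e \<omega> \<le> C * \<rho>)" if "\<omega> \<in> space \<Omega>" for \<omega>
      using edge_prob_bounds(2)[OF e that] by (simp add: M_indicator[OF e that])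
  qed
  then show "(\<integral>\<omega>. M (fst e) (snd e) \<omega> \<partial>\<Omega>) \<le> C * \<rho>"
    by (simp add: integral_eta_le[OF e])
qed

lemma prob_M_le:
  assumes e: "e \<in> pairs {1..n}"
  shows "prob {\<omega> \<in> space \<Omega>. M (fst e) (snd e) \<omega> = 1} \<le> C * \<rho>"
proof -
  have "prob {\<omega> \<in> space \<Omega>. M (fst e) (snd e) \<omega> = 1} =
      (\<integral>\<omega>. indicator {\<omega> \<in> space \<Omega>. M (fst e) (snd e) \<omega> = 1} \<omega> \<partial>\<Omega>)"
    by (subst Bochner_Integration.integral_indicator) (auto intro!: arg_cong[where f = prob])
  also have "\<dots> = (\<integral>\<omega>. M (fst e) (snd e) \<omega> \<partial>\<Omega>)"
    by (intro Bochner_Integration.integral_cong) (auto simp: M_indicator[OF e] indicator_def)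
  finally show ?thesis
    using expectation_M_le(2)[OF e] by simp
qed

lemma prob_rho_hat_ge:
  assumes "0 < N2" "0 < K"
  shows "prob {\<omega> \<in> space \<Omega>. K * \<rho> \<le> rho_hat n M \<omega>} \<le> C / K"
proof -
  have rho_hat: "rho_hat n M = (\<lambda>\<omega>. (\<Sum>e\<in>pairs (D2 n). M (fst e) (snd e) \<omega>) / N2)"
    by (simp add: rho_hat_def[abs_def] split_beta')
  have "(\<integral>\<omega>. rho_hat n M \<omega> \<partial>\<Omega>) = (\<Sum>e\<in>pairs (D2 n). \<integral>\<omega>. M (fst e) (snd e) \<omega> \<partial>\<Omega>) / N2"
    using expectation_M_le(1)[OF pairs_D2] by (simp add: rho_hat)
  also have "\<dots> \<le> (\<Sum>e\<in>pairs (D2 n). C * \<rho>) / N2"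
    using assms(1) by (intro divide_right_mono sum_mono expectation_M_le(2) pairs_D2) auto
  also have "\<dots> = C * \<rho>"
    using assms(1) card_pairs_D2 by simp
  finally have E: "(\<integral>\<omega>. rho_hat n M \<omega> \<partial>\<Omega>) \<le> C * \<rho>" .
  have "prob {\<omega> \<in> space \<Omega>. K * \<rho> \<le> rho_hat n M \<omega>} \<le> (\<integral>\<omega>. rho_hat n M \<omega> \<partial>\<Omega>) / (K * \<rho>)"
  proof (rule integral_Markov_inequality_measure[where A = "{}"])
    show "integrable \<Omega> (rho_hat n M)"
      unfolding rho_hat using expectation_M_le(1)[OF pairs_D2] by simp
    show "AE \<omega> in \<Omega>. 0 \<le> rho_hat n M \<omega>"
      using M_indicator[OF pairs_D2] by (intro AE_I2) (auto simp: rho_hat intro!: divide_nonneg_nonneg sum_nonneg)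
  qed (use assms rho_pos in auto)
  also have "\<dots> \<le> (C * \<rho>) / (K * \<rho>)"
    using E assms rho_pos by (intro divide_right_mono) auto
  finally show ?thesis
    using rho_pos by simp
qed

text \<open>Markov's inequality in the extended form, so that integrability of
  \<open>sq_error\<close> need not be established first.\<close>

lemma prob_sq_error_ge:
  assumes "0 < t" "0 \<le> \<epsilon>"
    and "expected_sq_frobenius \<Omega> n (\<lambda>i j \<omega>. p_hat i j \<omega> - \<rho> * w (\<xi> i \<omega>) (\<xi> j \<omega>)) \<le> ennreal (\<epsilon> * t)"
  shows "prob {\<omega> \<in> space \<Omega>. t \<le> sq_error \<omega>} \<le> \<epsilon>"
proof -
  note [measurable] = sq_error_random
  have "emeasure \<Omega> {\<omega> \<in> space \<Omega>. 1 \<le> ennreal (1 / t) * ennreal (sq_error \<omega>)} \<le>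
      ennreal (1 / t) * (\<integral>\<^sup>+\<omega>. ennreal (sq_error \<omega>) * indicator (space \<Omega>) \<omega> \<partial>\<Omega>)"
    by (rule nn_integral_Markov_inequality) measurable
  also have "(\<integral>\<^sup>+\<omega>. ennreal (sq_error \<omega>) * indicator (space \<Omega>) \<omega> \<partial>\<Omega>) =
      expected_sq_frobenius \<Omega> n (\<lambda>i j \<omega>. p_hat i j \<omega> - \<rho> * w (\<xi> i \<omega>) (\<xi> j \<omega>))"
    unfolding expected_sq_frobenius_def sq_error_def by (intro nn_integral_cong) simp
  also have "ennreal (1 / t) * \<dots> \<le> ennreal (1 / t) * ennreal (\<epsilon> * t)"
    by (rule mult_left_mono[OF assms(3)]) simp
  also have "\<dots> = ennreal \<epsilon>"
    using assms(1,2) by (simp flip: ennreal_mult)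
  also have "{\<omega> \<in> space \<Omega>. 1 \<le> ennreal (1 / t) * ennreal (sq_error \<omega>)} = {\<omega> \<in> space \<Omega>. t \<le> sq_error \<omega>}"
  proof -
    have "1 \<le> ennreal (1 / t) * ennreal (sq_error \<omega>) \<longleftrightarrow> t \<le> sq_error \<omega>" for \<omega>
    proof -
      have "0 \<le> sq_error \<omega>"
        by (simp add: sq_error_def)
      then have "ennreal (1 / t) * ennreal (sq_error \<omega>) = ennreal (sq_error \<omega> / t)"
        using assms(1) by (simp flip: ennreal_mult)
      then show ?thesis
        using assms(1) by (simp add: field_simps)
    qed
    then show ?thesis
      by simp
  qed
  finally show ?thesis
    using assms(2) by (simp add: emeasure_eq_measure)
qed

lemma prob_dev_ge:
  assumes "0 < N2" "0 < \<delta>"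
  shows "prob {\<omega> \<in> space \<Omega>. \<delta> * N2 \<le> \<bar>\<Sum>e\<in>far_pairs. ipw_dev e \<omega>\<bar>}
    \<le> (C / (c\<^sup>2 * \<rho>) + 1 + real n * (C\<^sup>2 / c\<^sup>2 + 1)) / (N2 * \<delta>\<^sup>2)"
proof -
  let ?S = "\<lambda>\<omega>. \<Sum>e\<in>far_pairs. ipw_dev e \<omega>"
  have d: "0 < \<delta> * N2"
    by (intro mult_pos_pos assms)
  have "\<delta> * N2 \<le> \<bar>?S \<omega>\<bar> \<longleftrightarrow> (\<delta> * N2)\<^sup>2 \<le> (?S \<omega>)\<^sup>2" for \<omega>
    using abs_le_square_iff[of "\<delta> * N2" "?S \<omega>"] unfolding abs_of_pos[OF d] .
  then have sq: "{\<omega> \<in> space \<Omega>. \<delta> * N2 \<le> \<bar>?S \<omega>\<bar>} = {\<omega> \<in> space \<Omega>. (\<delta> * N2)\<^sup>2 \<le> (?S \<omega>)\<^sup>2}"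
    by (simp only:)
  have "prob {\<omega> \<in> space \<Omega>. (\<delta> * N2)\<^sup>2 \<le> (?S \<omega>)\<^sup>2} \<le> (\<integral>\<omega>. (?S \<omega>)\<^sup>2 \<partial>\<Omega>) / (\<delta> * N2)\<^sup>2"
  proof (rule integral_Markov_inequality_measure[where A = "{}" and u = "\<lambda>\<omega>. (?S \<omega>)\<^sup>2"])
    have "integrable \<Omega> (\<lambda>\<omega>. \<Sum>e\<in>far_pairs. \<Sum>e'\<in>far_pairs. ipw_dev e \<omega> * ipw_dev e' \<omega>)"
      by (intro Bochner_Integration.integrable_sum integrable_ipw_dev_mult far_pairsD(2))
    then show "integrable \<Omega> (\<lambda>\<omega>. (?S \<omega>)\<^sup>2)"
      unfolding power2_eq_square sum_product .
    show "AE \<omega> in \<Omega>. 0 \<le> (?S \<omega>)\<^sup>2"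
      by (intro AE_I2 zero_le_power2)
    show "0 < (\<delta> * N2)\<^sup>2"
      by (rule zero_less_power[OF d])
  qed (rule sets.empty_sets)
  also have "\<dots> \<le> (N2 * (C / (c\<^sup>2 * \<rho>) + 1 + real n * (C\<^sup>2 / c\<^sup>2 + 1))) / (\<delta> * N2)\<^sup>2"
    by (rule divide_right_mono[OF second_moment zero_le_power2])
  also have "\<dots> = (C / (c\<^sup>2 * \<rho>) + 1 + real n * (C\<^sup>2 / c\<^sup>2 + 1)) / (N2 * \<delta>\<^sup>2)"
  proof -
    have cancel: "(a * x) / (\<delta> * a)\<^sup>2 = x / (a * \<delta>\<^sup>2)" if "0 < a" for a x :: real
      using that assms(2) by (simp add: power2_eq_square field_simps)
    show ?thesis
      by (rule cancel[OF assms(1)])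
  qed
  finally show ?thesis
    unfolding sq .
qed

text \<open>A union bound over five bad events, outside of which \<open>Pi_weighted_gt\<close>
  applies and \<open>M k l \<omega> = 0\<close>. The choice \<open>K = C / \<delta>\<close> makes
  the density event cost \<open>\<delta>\<close>; a small test survival costs
  \<open>\<alpha> + 3 * \<delta>\<close>, the estimation error \<open>\<epsilon>\<close>, the
  deviation the quotient, and an observed test pair \<open>C * \<rho>\<close>.\<close>

lemma coverage_ge:
  assumes N2: "0 < N2" and \<alpha>: "0 \<le> \<alpha>" and \<delta>: "0 < \<delta>" and K: "K = C / \<delta>" "K * \<rho> < 1"
    and \<rho>: "\<rho> * C < 1" and small: "K * \<rho> + (real n + 1) / N2 \<le> \<delta>"
    and \<epsilon>: "0 \<le> \<epsilon>"
      "expected_sq_frobenius \<Omega> n (\<lambda>i j \<omega>. p_hat i j \<omega> - \<rho> * w (\<xi> i \<omega>) (\<xi> j \<omega>))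
        \<le> ennreal (\<epsilon> * (\<delta>\<^sup>2 * c ^ 4 / K * N2 * \<rho> ^ 3))"
  shows "1 - \<alpha> - 4 * \<delta> - \<epsilon> - (C / (c\<^sup>2 * \<rho>) + 1 + real n * (C\<^sup>2 / c\<^sup>2 + 1)) / (N2 * \<delta>\<^sup>2) - C * \<rho>
    \<le> \<P>(\<omega> in \<Omega>. Y k l \<omega> \<in> C_weighted MY \<alpha> n X Y M h s p_hat k l \<omega> \<bar> M k l \<omega> = 0)"
proof -
  note kl = pairs_D2[OF kl_pairs]
  have C0: "0 < C"
    using c_pos C_ge_c by simp
  then have K0: "0 < K"
    using K \<delta> by simp
  let ?Pi = "\<lambda>\<omega>. Pi_weighted n X Y M h s p_hat k l \<omega> (Y k l \<omega>)"
  let ?t = "\<delta>\<^sup>2 * c ^ 4 / K * N2 * \<rho> ^ 3"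
  have t: "0 < ?t"
    using \<delta> c_pos K0 N2 rho_pos by (intro mult_pos_pos divide_pos_pos zero_less_power) simp_all
  define B1 where "B1 = {\<omega> \<in> space \<Omega>. K * \<rho> \<le> rho_hat n M \<omega>}"
  define B2 where "B2 = {\<omega> \<in> space \<Omega>. ?t \<le> sq_error \<omega>}"
  define B3 where "B3 = {\<omega> \<in> space \<Omega>. \<delta> * N2 \<le> \<bar>\<Sum>e\<in>far_pairs. ipw_dev e \<omega>\<bar>}"
  define B4 where "B4 = {\<omega> \<in> space \<Omega>. test_survival \<omega> \<le> \<alpha> + 3 * \<delta>}"
  define B5 where "B5 = {\<omega> \<in> space \<Omega>. M k l \<omega> = 1}"
  define G where "G = {\<omega> \<in> space \<Omega>. \<alpha> < ?Pi \<omega> \<and> M k l \<omega> = 0}"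
  have Mkl [measurable]: "M k l \<in> borel_measurable \<Omega>"
    using M_random[OF kl] by simp
  have dev [measurable]: "(\<lambda>\<omega>. \<Sum>e\<in>far_pairs. ipw_dev e \<omega>) \<in> borel_measurable \<Omega>"
    by (intro borel_measurable_sum borel_measurable_diff ipw_random test_survival_random far_pairsD(2))
  note [measurable] = rho_hat_random sq_error_random test_survival_random
  have B_sets: "B1 \<in> events" "B2 \<in> events" "B3 \<in> events" "B4 \<in> events" "B5 \<in> events"
    unfolding B1_def B2_def B3_def B4_def B5_def by measurable
  have "G = {\<omega> \<in> space \<Omega>. \<alpha> < ?Pi \<omega>} \<inter> {\<omega> \<in> space \<Omega>. M k l \<omega> = 0}"
    by (auto simp: G_def)
  also have "\<dots> \<in> events"
    by (intro sets.Int Pi_weighted_random) measurable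
  finally have G_sets: "G \<in> events" .
  have M01: "M k l \<omega> = 0 \<or> M k l \<omega> = 1" if "\<omega> \<in> space \<Omega>" for \<omega>
    using M_indicator[OF kl that] by auto
  have "1 = prob (space \<Omega>)"
    by (simp add: prob_space)
  also have "\<dots> \<le> prob (G \<union> B1 \<union> B2 \<union> B3 \<union> B4 \<union> B5)"
  proof (rule finite_measure_mono_AE)
    show "AE \<omega> in \<Omega>. \<omega> \<in> space \<Omega> \<longrightarrow> \<omega> \<in> G \<union> B1 \<union> B2 \<union> B3 \<union> B4 \<union> B5"
      using p_hat_ge
    proof eventually_elim
      case (elim \<omega>)
      show ?case
      proof (intro impI, rule ccontr)
        assume \<omega>: "\<omega> \<in> space \<Omega>" and bad: "\<omega> \<notin> G \<union> B1 \<union> B2 \<union> B3 \<union> B4 \<union> B5"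
        have "\<alpha> < ?Pi \<omega>"
          using bad \<omega> by (intro Pi_weighted_gt[OF \<omega> elim N2 \<alpha> \<delta> K0 K(2) small])
            (simp_all add: B1_def B2_def B3_def B4_def)
        with bad \<omega> M01[OF \<omega>] show False
          by (auto simp: G_def B5_def)
      qed
    qed
  qed (intro sets.Un G_sets B_sets)
  also have "\<dots> \<le> prob G + prob B1 + prob B2 + prob B3 + prob B4 + prob B5"
    by (intro order.trans[OF measure_Un_le] add_right_mono order_refl sets.Un G_sets B_sets)
  finally have "1 \<le> prob G + prob B1 + prob B2 + prob B3 + prob B4 + prob B5" .
  moreover have "prob B1 \<le> \<delta>"
    using prob_rho_hat_ge[OF N2 K0] C0 unfolding B1_def K(1) by simp
  moreover have "prob B2 \<le> \<epsilon>"
    unfolding B2_def by (rule prob_sq_error_ge[OF t \<epsilon>])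
  moreover have "prob B3 \<le> (C / (c\<^sup>2 * \<rho>) + 1 + real n * (C\<^sup>2 / c\<^sup>2 + 1)) / (N2 * \<delta>\<^sup>2)"
    unfolding B3_def by (rule prob_dev_ge[OF N2 \<delta>])
  moreover have "prob B4 \<le> \<alpha> + 3 * \<delta>"
    unfolding B4_def using \<alpha> \<delta> by (intro prob_test_survival_le) simp
  moreover have B5: "prob B5 \<le> C * \<rho>"
    unfolding B5_def using prob_M_le[OF kl] by simp
  \<comment> \<open>Conditioning divides the joint probability by a number in (0, 1], which only
    increases it; \<open>\<rho> * C < 1\<close> keeps the divisor positive.\<close>
  moreover have "prob G \<le> \<P>(\<omega> in \<Omega>. Y k l \<omega> \<in> C_weighted MY \<alpha> n X Y M h s p_hat k l \<omega> \<bar> M k l \<omega> = 0)"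
  proof -
    let ?Z = "{\<omega> \<in> space \<Omega>. M k l \<omega> = 0}"
    have Z: "?Z \<in> events"
      by measurable
    have "Y k l \<in> \<Omega> \<rightarrow>\<^sub>M MY"
      using edge_sources_subset[OF kl] by (intro measurable_sig_random[OF Y_measurable_sig[OF kl]]) auto
    from measurable_space[OF this]
    have G_eq: "G = {\<omega> \<in> space \<Omega>. Y k l \<omega> \<in> C_weighted MY \<alpha> n X Y M h s p_hat k l \<omega> \<and> M k l \<omega> = 0}"
      by (auto simp: G_def C_weighted_def)
    have "space \<Omega> = ?Z \<union> B5"
      using M01 by (auto simp: B5_def)
    then have "1 \<le> prob ?Z + prob B5"
      using measure_Un_le[OF Z B_sets(5)] prob_space by simp
    then have "0 < prob ?Z"
      using B5 \<rho> by (simp add: mult.commute)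
    then have "prob G \<le> prob G / prob ?Z"
      using prob_le_1[of ?Z] by (simp add: le_divide_eq mult_left_le)
    then show ?thesis
      unfolding cond_prob_def G_eq .
  qed
  ultimately show ?thesis
    by linarith
qed

end

section \<open>Asymptotic coverage\<close>

theorem theorem6p1:
  fixes \<Omega> :: "nat \<Rightarrow> 'a measure"
    and MX :: "'x measure" and MZ :: "'z measure" and MV :: "'v measure" and MY :: "'y measure"
    and MP :: "'p measure"
    and LV :: "('x \<times> real \<times> 'z) measure" and LN :: "'v measure"
    and g :: "'x \<times> 'z \<times> 'x \<times> 'z \<times> 'v \<Rightarrow> 'y" and w :: "real \<Rightarrow> real \<Rightarrow> real"
    and \<rho> :: "nat \<Rightarrow> real"
    and X :: "nat \<Rightarrow> nat \<Rightarrow> 'a \<Rightarrow> 'x" and \<xi> :: "nat \<Rightarrow> nat \<Rightarrow> 'a \<Rightarrow> real"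
    and \<zeta> :: "nat \<Rightarrow> nat \<Rightarrow> 'a \<Rightarrow> 'z"
    and \<eta> :: "nat \<Rightarrow> nat \<times> nat \<Rightarrow> 'a \<Rightarrow> real" and \<nu> :: "nat \<Rightarrow> nat \<times> nat \<Rightarrow> 'a \<Rightarrow> 'v"
    and Y :: "nat \<Rightarrow> nat \<Rightarrow> nat \<Rightarrow> 'a \<Rightarrow> 'y" and M :: "nat \<Rightarrow> nat \<Rightarrow> nat \<Rightarrow> 'a \<Rightarrow> real"
    and h :: "nat \<Rightarrow> 'a \<Rightarrow> 'x \<Rightarrow> 'x \<Rightarrow> 'p" and s :: "nat \<Rightarrow> 'a \<Rightarrow> 'y \<Rightarrow> 'p \<Rightarrow> real"
    and p_hat :: "nat \<Rightarrow> nat \<Rightarrow> nat \<Rightarrow> 'a \<Rightarrow> real"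
    and k l :: "nat \<Rightarrow> nat" and \<alpha> c :: real
  assumes model: "\<And>n. even n \<Longrightarrow>
      dyadic_regression (\<Omega> n) MX MZ MV MY LV LN g w n (\<rho> n)
        (X n) (\<xi> n) (\<zeta> n) (\<eta> n) (\<nu> n) (Y n) (M n)"
    and rho_to_0: "(\<rho> \<longlongrightarrow> 0) along_even"
    and h_trained: "\<And>n. even n \<Longrightarrow>
      (\<lambda>(\<omega>, x, x'). h n \<omega> x x')
        \<in> observed_data (\<Omega> n) MX MY (X n) (Y n) (M n) (D1 n) \<Otimes>\<^sub>M MX \<Otimes>\<^sub>M MX \<rightarrow>\<^sub>M MP"
    and s_fitted: "\<And>n. even n \<Longrightarrow>
      (\<lambda>(\<omega>, y, y'). s n \<omega> y y')
        \<in> borel_measurable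
            (observed_data (\<Omega> n) MX MY (X n) (Y n) (M n) (D1 n) \<Otimes>\<^sub>M MY \<Otimes>\<^sub>M MP)"
    and p_hat_estimator: "\<And>n i j. even n \<Longrightarrow> i \<in> {1..n} \<Longrightarrow> j \<in> {1..n} \<Longrightarrow>
      p_hat n i j \<in> borel_measurable (observed_data (\<Omega> n) MX MY (X n) (Y n) (M n) {1..n})"
    and alpha: "0 < \<alpha>" "\<alpha> < 1"
    and a: "0 < c" "\<And>u v. u \<in> {0..1} \<Longrightarrow> v \<in> {0..1} \<Longrightarrow> w u v \<ge> c"
      "\<And>n. even n \<Longrightarrow> AE \<omega> in \<Omega> n. \<forall>i\<in>{1..n}. \<forall>j\<in>{1..n}. p_hat n i j \<omega> / \<rho> n \<ge> c"
    and b: "filterlim (\<lambda>n. \<rho> n / (sqrt (ln (real n)) / real n)) at_top along_even"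
    and c: "((\<lambda>n. ennreal (1 / ((real n)\<^sup>2 * \<rho> n ^ 3)) *
        expected_sq_frobenius (\<Omega> n) n
          (\<lambda>i j \<omega>. p_hat n i j \<omega> - \<rho> n * w (\<xi> n i \<omega>) (\<xi> n j \<omega>))) \<longlongrightarrow> 0) along_even"
    and kl: "\<forall>\<^sub>F n in along_even. k n \<in> D2 n \<and> l n \<in> D2 n \<and> k n < l n"
  shows "Liminf along_even (\<lambda>n. ereal (\<P>(\<omega> in \<Omega> n.
            Y n (k n) (l n) \<omega>
              \<in> C_weighted MY \<alpha> n (X n) (Y n) (M n) (h n) (s n) (p_hat n) (k n) (l n) \<omega>
            \<bar> M n (k n) (l n) \<omega> = 0)))
         \<ge> ereal (1 - \<alpha>)"
proof -
  \<comment> \<open>The graphon is common to all \<open>n\<close>, so the even index 0 supplies its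
    upper bound.\<close>
  obtain C where C: "\<And>u v. u \<in> {0..1} \<Longrightarrow> v \<in> {0..1} \<Longrightarrow> w u v \<le> C"
    using dyadic_regression.graphon[OF model[of 0]] unfolding normalized_graphon_def
    by (meson less_imp_le even_zero)
  have cC: "c \<le> C"
    using a(2)[of 0 0] C[of 0 0] by simp
  then have C0: "0 < C"
    using a(1) by simp
  let ?P = "\<lambda>n. \<P>(\<omega> in \<Omega> n.
            Y n (k n) (l n) \<omega>
              \<in> C_weighted MY \<alpha> n (X n) (Y n) (M n) (h n) (s n) (p_hat n) (k n) (l n) \<omega>
            \<bar> M n (k n) (l n) \<omega> = 0)"
  \<comment> \<open>Besides the \<open>4 * \<delta>\<close> in \<open>coverage_ge\<close>, one
    \<open>\<delta>\<close> each is allotted to \<open>\<epsilon>\<close>, to the variance quotient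
    and to \<open>C * \<rho> n\<close>.\<close>
  have lower: "\<forall>\<^sub>F n in along_even. 1 - \<alpha> - 7 * \<delta> \<le> ?P n" if \<delta>: "0 < \<delta>" for \<delta>
  proof -
    define K where "K = C / \<delta>"
    have K0: "0 < K"
      using C0 \<delta> by (simp add: K_def)
    \<comment> \<open>The sum of the coefficients in the second moment bound, once 1/rho and 1 are
      both replaced by n.\<close>
    define Q where "Q = C / c\<^sup>2 + 1 + (C\<^sup>2 / c\<^sup>2 + 1)"
    have ev_large: "\<forall>\<^sub>F n in along_even. r \<le> real n" for r
      using filterlim_real_sequentially unfolding filterlim_at_top by (intro eventually_along_evenI) simp
    have ev_rho: "\<forall>\<^sub>F n in along_even. \<rho> n < r" if "0 < r" for r
      using order_tendstoD(2)[OF rho_to_0 that] .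
    \<comment> \<open>The threshold for \<open>sq_error\<close> is \<open>\<kappa>\<close> times the
      number of pairs times rho^3. Markov's inequality with \<open>\<epsilon> = \<delta>\<close> and
      at least n^2 / 16 pairs lead to the bound \<open>\<delta> * \<kappa> / 16\<close> on the
      normalised error.\<close>
    define \<kappa> where "\<kappa> = \<delta>\<^sup>2 * c ^ 4 / K"
    have \<kappa>: "0 < \<kappa>"
      using \<delta> a(1) K0 by (simp add: \<kappa>_def)
    have "\<forall>\<^sub>F n in along_even. ennreal (1 / ((real n)\<^sup>2 * \<rho> n ^ 3)) *
        expected_sq_frobenius (\<Omega> n) n
          (\<lambda>i j \<omega>. p_hat n i j \<omega> - \<rho> n * w (\<xi> n i \<omega>) (\<xi> n j \<omega>)) < ennreal (\<delta> * \<kappa> / 16)"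
      using \<delta> \<kappa> by (intro order_tendstoD(2)[OF c]) simp
    moreover have "\<forall>\<^sub>F n in along_even. 1 \<le> \<rho> n / (sqrt (ln (real n)) / real n)"
      using b unfolding filterlim_at_top by simp
    moreover have "\<forall>\<^sub>F n in along_even. \<rho> n < 1 / C" "\<forall>\<^sub>F n in along_even. \<rho> n < 1 / K"
        "\<forall>\<^sub>F n in along_even. \<rho> n < \<delta> / (2 * K)" "\<forall>\<^sub>F n in along_even. \<rho> n < \<delta> / C"
      using C0 K0 \<delta> by (intro ev_rho; simp)+
    ultimately show ?thesis
      \<comment> \<open>The value 4 serves \<open>choose_half_ge\<close> and makes the logarithm at
        least 1; \<open>64 / \<delta>\<close> gives 32/n <= delta/2 below, and the last threshold
        brings the variance quotient down to \<open>\<delta>\<close>.\<close>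
      using kl eventually_even_along_even ev_large[of 4] ev_large[of "64 / \<delta>"] ev_large[of "16 * Q / \<delta> ^ 3"]
    proof eventually_elim
      case (elim n)
      let ?N = "real (n div 2 choose 2)"
      have n: "even n" "4 \<le> n"
        using elim by simp_all
      interpret dyadic_regression "\<Omega> n" MX MZ MV MY LV LN g w n "\<rho> n" "X n" "\<xi> n" "\<zeta> n" "\<eta> n" "\<nu> n" "Y n" "M n"
        by (rule model[OF n(1)])
      interpret weighted_conformal "\<Omega> n" MX MZ MV MY LV LN g w n "\<rho> n" "X n" "\<xi> n" "\<zeta> n" "\<eta> n" "\<nu> n" "Y n" "M n"
        MP "h n" "s n" "p_hat n" "k n" "l n" c C
      proof
        show "\<rho> n * C \<le> 1"
          using elim(3) C0 by (simp add: field_simps)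
        show "(k n, l n) \<in> pairs (D2 n)"
          using elim(7) by (simp add: pairs_def)
      qed (use n h_trained s_fitted p_hat_estimator a C in auto)
      have n0: "0 < real n"
        using n by simp
      \<comment> \<open>This turns (b) into 1/rho <= n, since the square root of the logarithm is at
        least 1.\<close>
      have rho_ge: "1 / real n \<le> \<rho> n"
      proof -
        have "exp 1 \<le> real n"
          using exp_le n by linarith
        then have "1 \<le> ln (real n)"
          using n0 by (simp add: ln_ge_iff)
        then have s1: "1 \<le> sqrt (ln (real n))"
          by simp
        then have "0 < sqrt (ln (real n)) / real n"
          using n0 by (intro divide_pos_pos) linarith+
        then have "sqrt (ln (real n)) / real n \<le> \<rho> n"
          using elim(2) by (simp only: le_divide_eq_1_pos)
        moreover have "1 / real n \<le> sqrt (ln (real n)) / real n"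
          using s1 by (rule divide_right_mono) simp
        ultimately show ?thesis
          by linarith
      qed
      have N_ge: "(real n)\<^sup>2 / 16 \<le> ?N"
        by (rule choose_half_ge[OF n])
      then have N0: "0 < ?N"
        using n0 by (smt (verit) divide_pos_pos zero_less_power)
      have "(real n + 1) / ?N \<le> (2 * real n) / ((real n)\<^sup>2 / 16)"
        using N_ge n0 n by (intro frac_le) auto
      also have "\<dots> = 32 / real n"
        using n0 by (simp add: power2_eq_square)
      also have "\<dots> \<le> \<delta> / 2"
        using elim(10) n0 \<delta> by (simp add: field_simps)
      finally have "(real n + 1) / ?N \<le> \<delta> / 2" .
      moreover have "K * \<rho> n \<le> \<delta> / 2"
        using elim(5) K0 by (simp add: field_simps)
      ultimately have small: "K * \<rho> n + (real n + 1) / ?N \<le> \<delta>"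
        by linarith
      have var: "(C / (c\<^sup>2 * \<rho> n) + 1 + real n * (C\<^sup>2 / c\<^sup>2 + 1)) / (?N * \<delta>\<^sup>2) \<le> \<delta>"
      proof -
        have "C / (c\<^sup>2 * \<rho> n) = (C / c\<^sup>2) * (1 / \<rho> n)"
          by simp
        also have "\<dots> \<le> (C / c\<^sup>2) * real n"
          using rho_ge rho_pos n0 C0 by (intro mult_left_mono) (auto simp: field_simps)
        finally have "C / (c\<^sup>2 * \<rho> n) + 1 + real n * (C\<^sup>2 / c\<^sup>2 + 1) \<le> real n * Q"
          using n by (simp add: Q_def algebra_simps)
        moreover have "0 < Q"
          using C0 a(1) by (simp add: Q_def add_pos_pos)
        ultimately have "(C / (c\<^sup>2 * \<rho> n) + 1 + real n * (C\<^sup>2 / c\<^sup>2 + 1)) / (?N * \<delta>\<^sup>2)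
            \<le> (real n * Q) / ((real n)\<^sup>2 / 16 * \<delta>\<^sup>2)"
          using N_ge n0 \<delta> by (intro frac_le mult_right_mono) auto
        also have "\<dots> = 16 * Q / \<delta> ^ 3 * \<delta> / real n"
          using n0 \<delta> by (simp add: power2_eq_square power3_eq_cube mult_ac)
        also have "\<dots> \<le> \<delta>"
          using elim(11) n0 \<delta> by (simp add: divide_le_eq mult.commute mult_left_mono)
        finally show ?thesis .
      qed
      have frob: "expected_sq_frobenius (\<Omega> n) n
          (\<lambda>i j \<omega>. p_hat n i j \<omega> - \<rho> n * w (\<xi> n i \<omega>) (\<xi> n j \<omega>))
          \<le> ennreal (\<delta> * (\<delta>\<^sup>2 * c ^ 4 / K * ?N * \<rho> n ^ 3))" (is "?E \<le> _")
      proof -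
        let ?z = "(real n)\<^sup>2 * \<rho> n ^ 3"
        have z: "0 < ?z"
          using n0 rho_pos by simp
        have one: "ennreal x * ennreal (1 / x) = 1" if "0 < x" for x :: real
          using that by (simp flip: ennreal_mult)
        \<comment> \<open>The normalising factor is undone by multiplying by its reciprocal inside
          \<open>ennreal\<close>, where finiteness of \<open>?E\<close> is not presupposed.\<close>
        have "?E = ennreal ?z * (ennreal (1 / ?z) * ?E)"
          by (simp only: mult.assoc[symmetric] one[OF z] mult_1_left)
        also have "\<dots> \<le> ennreal ?z * ennreal (\<delta> * \<kappa> / 16)"
          using elim(1) by (intro mult_left_mono) auto
        also have "\<dots> = ennreal (\<delta> * \<kappa> * \<rho> n ^ 3 * ((real n)\<^sup>2 / 16))"
          using z \<delta> \<kappa> by (simp flip: ennreal_mult add: mult_ac)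
        also have "\<dots> \<le> ennreal (\<delta> * \<kappa> * \<rho> n ^ 3 * ?N)"
          using N_ge \<delta> \<kappa> rho_pos by (intro ennreal_leI mult_left_mono) auto
        also have "\<delta> * \<kappa> * \<rho> n ^ 3 * ?N = \<delta> * (\<delta>\<^sup>2 * c ^ 4 / K * ?N * \<rho> n ^ 3)"
          by (simp add: \<kappa>_def)
        finally show ?thesis .
      qed
      have "1 - \<alpha> - 4 * \<delta> - \<delta> - (C / (c\<^sup>2 * \<rho> n) + 1 + real n * (C\<^sup>2 / c\<^sup>2 + 1)) / (?N * \<delta>\<^sup>2) - C * \<rho> n
          \<le> ?P n"
        using elim(3,4) K0 C0 \<delta> alpha(1)
        by (intro coverage_ge[where K = K] N0 small frob) (simp_all add: K_def field_simps)
      moreover have "C * \<rho> n \<le> \<delta>"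
        using elim(6) C0 by (simp add: field_simps)
      ultimately show ?case
        using var by linarith
    qed
  qed
  show ?thesis
  proof (rule ereal_le_epsilon2)
    fix e :: real assume e: "0 < e"
    have "ereal (1 - \<alpha> - e) \<le> Liminf along_even (\<lambda>n. ereal (?P n))"
      using lower[of "e / 7"] e by (intro Liminf_bounded) simp
    then show "ereal (1 - \<alpha>) \<le> Liminf along_even (\<lambda>n. ereal (?P n)) + ereal e"
      by (simp add: ereal_minus_le_iff flip: ereal_minus)
  qed
qed

end
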